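(* In the setting described in the context (observations $X_{t_0},\dots,X_{t_n}$ of $X_t=Z_t+\int_0^t\mu_{\xi_0}(s)\,ds$, with $h_n\to0$ and $nh_n\to\infty$), let $f:\mathbb R\to\mathbb R^q$ be a measurable function such that $f\in C^1(\mathbb R)$ and there exists $C>0$ such that $|f(x)|+|\partial_xf(x)|\lesssim1+|x|^C$. Suppose that $K=K_{\sigma_0}$ satisfies: (i) $K(t)\to0$ as $t\to\infty$; (ii) $K\in C^2([0,\infty))$ with $K'(0)=0$ and $|K''(0)|>0$, that is, $K(t)=K(0)+\frac12K''(0)t^2+o(t^3)$ as $t\to0$; (iii) $K\in C^2([0,\infty))$ and $K'(t)\to0$ as $t\to\infty$; and that (iv) there exists a bounded function $\gamma\in L^1([0,\infty))$ such that $\sup_{\xi\in\Xi}|\partial_\xi\mu_\xi(t)|\le\gamma(t)$ for each $t\ge0$. Suppose that an estimator $\widehat\xi_n$ with $\widehat\xi_n\to\xi_0$ in probability is given, and that $$\inf_{\sigma\in\overline\Pi:\,|\sigma-\sigma_0|>\varepsilon}|\Phi(\sigma)|>0\quad\text{for all }\varepsilon>0.$$ Then the Z-estimator $\widetilde\sigma_n$ defined by $\Phi_n(\widetilde\sigma_n)=0$ is consistent: $\widetilde\sigma_n\to\sigma_0$ in probability as $n\to\infty$.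
   Context: Setting. $\Xi\subset\mathbb R^p$ and $\Pi\subset\mathbb R^q$ are open, convex and bounded, $\Theta=\Xi\times\Pi$, and bars denote Euclidean closures. $\{\mu_\xi:[0,\infty)\to\mathbb R\mid\xi\in\overline\Xi\}$ and $\{K_\sigma:[0,\infty)\to(0,\infty)\mid\sigma\in\overline\Pi\}$ are parametric families, with true value $\theta_0=(\xi_0,\sigma_0)\in\Theta$; write $K=K_{\sigma_0}$. $Z=(Z_t)_{t\ge0}$ is a centered stationary Gaussian process with kernel $K$, i.e. $\mathbb E[Z_t]=0$ and $\mathbb E[Z_tZ_s]=K(|t-s|)$. The observed process is $X_t=Z_t+\int_0^t\mu_{\xi_0}(s)\,ds$, $X_0=Z_0$, observed at $t_i=ih_n$, $i=0,\dots,n$, with $h_n>0$, $h_n\to0$ and $nh_n\to\infty$ as $n\to\infty$. Let $\phi_v$ denote the density of $\mathcal N(0,v)$. Given $\widehat\xi_n$, put $Y_i^n=X_{t_i}-\int_0^{t_i}\mu_{\widehat\xi_n}(s)\,ds$ and, for $\sigma\in\overline\Pi$, $$\Phi_n(\sigma)=\frac1n\sum_{i=1}^nf(Y_{i-1}^n)-\int_{\mathbb R}f(z)\phi_{K_\sigma(0)}(z)\,dz,\qquad \Phi(\sigma)=\int_{\mathbb R}f(z)\left[\phi_{K_{\sigma_0}(0)}(z)-\phi_{K_\sigma(0)}(z)\right]dz.$$ The notation $a(x)\lesssim b(x)$ means $a(x)\le C'b(x)$ for all $x$, with a constant $C'>0$. *)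

theory Defs
  imports "HOL-Probability.Probability" "HOL-Library.Landau_Symbols"
begin

(* A Gaussian law may be degenerate (a point mass), which normal_density does not cover. *)
definition gaussian_rv :: "'a measure \<Rightarrow> ('a \<Rightarrow> real) \<Rightarrow> bool" where
  "gaussian_rv M X \<longleftrightarrow> X \<in> borel_measurable M \<and>
     ((\<exists>m s. 0 < s \<and> distributed M lborel X (\<lambda>x. ennreal (normal_density m s x))) \<or>
      (\<exists>m. AE \<omega> in M. X \<omega> = m))"

definition gaussian_process :: "'a measure \<Rightarrow> 't set \<Rightarrow> ('t \<Rightarrow> 'a \<Rightarrow> real) \<Rightarrow> bool" where
  "gaussian_process M T Z \<longleftrightarrow>
     (\<forall>I a. finite I \<and> I \<subseteq> T \<longrightarrow> gaussian_rv M (\<lambda>\<omega>. \<Sum>t\<in>I. a t * Z t \<omega>))"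

definition centered_stationary_gaussian ::
    "'a measure \<Rightarrow> (real \<Rightarrow> real) \<Rightarrow> (real \<Rightarrow> 'a \<Rightarrow> real) \<Rightarrow> bool" where
  "centered_stationary_gaussian M k Z \<longleftrightarrow>
     gaussian_process M {0..} Z \<and>
     (\<forall>t\<ge>0. integral\<^sup>L M (Z t) = 0) \<and>
     (\<forall>t\<ge>0. \<forall>s\<ge>0. integral\<^sup>L M (\<lambda>\<omega>. Z t \<omega> * Z s \<omega>) = k \<bar>t - s\<bar>)"

definition tendsto_in_prob ::
    "'a measure \<Rightarrow> (nat \<Rightarrow> 'a \<Rightarrow> 'b::metric_space) \<Rightarrow> 'b \<Rightarrow> bool" where
  "tendsto_in_prob M T c \<longleftrightarrow>
     (\<forall>\<epsilon>>0. (\<lambda>n. measure M {\<omega> \<in> space M. dist (T n \<omega>) c > \<epsilon>}) \<longlonglongrightarrow> 0)"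

definition is_estimator ::
    "'a measure \<Rightarrow> (nat \<Rightarrow> 'a \<Rightarrow> real) \<Rightarrow> nat \<Rightarrow> 'b::topological_space set \<Rightarrow> ('a \<Rightarrow> 'b) \<Rightarrow> bool" where
  "is_estimator M D n S T \<longleftrightarrow>
     (\<exists>g \<in> borel_measurable (PiM {0..n} (\<lambda>_. borel)).
        \<forall>\<omega>\<in>space M. T \<omega> = g (\<lambda>i\<in>{0..n}. D i \<omega>) \<and> T \<omega> \<in> S)"

(* One-sided derivatives at 0, which is what "at t within {0..}" gives there. *)
definition C2_halfline :: "(real \<Rightarrow> real) \<Rightarrow> (real \<Rightarrow> real) \<Rightarrow> (real \<Rightarrow> real) \<Rightarrow> bool" where
  "C2_halfline k k' k'' \<longleftrightarrow>
     (\<forall>t\<ge>0. (k has_real_derivative k' t) (at t within {0..})) \<and>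
     (\<forall>t\<ge>0. (k' has_real_derivative k'' t) (at t within {0..})) \<and>
     continuous_on {0..} k''"

definition gauss_dens :: "real \<Rightarrow> real \<Rightarrow> real" where
  "gauss_dens v z = normal_density 0 (sqrt v) z"

definition trend :: "('p \<Rightarrow> real \<Rightarrow> real) \<Rightarrow> 'p \<Rightarrow> real \<Rightarrow> real" where
  "trend \<mu> \<xi> t = set_lebesgue_integral lebesgue {0..t} (\<mu> \<xi>)"

definition obs_time :: "(nat \<Rightarrow> real) \<Rightarrow> nat \<Rightarrow> nat \<Rightarrow> real" where
  "obs_time h n i = real i * h n"

definition Y_resid ::
    "('p \<Rightarrow> real \<Rightarrow> real) \<Rightarrow> (real \<Rightarrow> 'a \<Rightarrow> real) \<Rightarrow> (nat \<Rightarrow> real) \<Rightarrow> (nat \<Rightarrow> 'a \<Rightarrow> 'p) \<Rightarrow>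
     nat \<Rightarrow> nat \<Rightarrow> 'a \<Rightarrow> real" where
  "Y_resid \<mu> X h \<xi>hat n i \<omega> =
     X (obs_time h n i) \<omega> - trend \<mu> (\<xi>hat n \<omega>) (obs_time h n i)"

definition Phi_n ::
    "(real \<Rightarrow> 'v::euclidean_space) \<Rightarrow> ('s \<Rightarrow> real \<Rightarrow> real) \<Rightarrow> ('p \<Rightarrow> real \<Rightarrow> real) \<Rightarrow>
     (real \<Rightarrow> 'a \<Rightarrow> real) \<Rightarrow> (nat \<Rightarrow> real) \<Rightarrow> (nat \<Rightarrow> 'a \<Rightarrow> 'p) \<Rightarrow> nat \<Rightarrow> 'a \<Rightarrow> 's \<Rightarrow> 'v" where
  "Phi_n f K \<mu> X h \<xi>hat n \<omega> \<sigma> =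
     (1 / real n) *\<^sub>R (\<Sum>i=1..n. f (Y_resid \<mu> X h \<xi>hat n (i - 1) \<omega>))
     - (LINT z|lborel. gauss_dens (K \<sigma> 0) z *\<^sub>R f z)"

definition Phi ::
    "(real \<Rightarrow> 'v::euclidean_space) \<Rightarrow> ('s \<Rightarrow> real \<Rightarrow> real) \<Rightarrow> 's \<Rightarrow> 's \<Rightarrow> 'v" where
  "Phi f K \<sigma>\<^sub>0 \<sigma> =
     (LINT z|lborel. (gauss_dens (K \<sigma>\<^sub>0 0) z - gauss_dens (K \<sigma> 0) z) *\<^sub>R f z)"

end

theory Submission
  imports Defs
begin

text \<open>
  If \<open>\<Phi>\<^sub>n\<close> vanishes at the estimate, then \<open>\<Phi>\<close> takes there the value
  \<open>E f(Z\<^sub>0) - (1/n) \<Sum> f(Y\<^sub>i)\<close>. Identifiability keeps \<open>\<Phi>\<close> away from zero outside every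
  ball around the true parameter, so consistency follows once this difference tends to zero in
  probability. It splits into two errors.

  The plug-in error replaces \<open>Y\<^sub>i\<close> by \<open>Z\<^sub>i\<close>. Integrating the bound on the gradient of
  \<open>\<mu>\<close> shows that \<open>Y\<^sub>i\<close> and \<open>Z\<^sub>i\<close> differ, uniformly in \<open>i\<close>, by at most a constant times the
  error of the trend estimator (\<open>trend_lipschitz\<close>); the mean value theorem for \<open>f\<close>
  (\<open>C1_increment_bound\<close>) then costs a factor of polynomial growth in \<open>Z\<^sub>i\<close>, whose expectation
  is the same for all \<open>i\<close>.

  The remaining error is the law of large numbers for \<open>f(Z\<^sub>i)\<close> (\<open>gaussian_lln_vector\<close>). It is
  proved in \<open>L\<^sup>1\<close>, where the functions that obey it form a closed subspace, and so
  it has to be shown only for a family with dense span. The family of waves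
  \<open>x \<mapsto> cos (u x + a)\<close> has two advantages. A product of two waves in \<open>Z\<^sub>s\<close> and \<open>Z\<^sub>t\<close> is
  half the sum of two waves in \<open>Z\<^sub>s - Z\<^sub>t\<close> and \<open>Z\<^sub>s + Z\<^sub>t\<close>, so that their covariance is
  an explicit function of the kernel that only involves one-dimensional Gaussian laws, and it tends
  to zero with \<open>K(|s - t|)\<close>. In the double sum that gives the variance of the empirical mean, the
  pairs at a bounded time distance have the proportion \<open>O(1/(n h\<^sub>n) + 1/n)\<close>, hence the variance
  vanishes (\<open>lln_if_covariances_decay\<close>). The span of the waves is dense because it contains all
  polynomials in \<open>sin (w x)\<close>, which approximate every continuous function on a given interval while
  they stay bounded outside it (\<open>trig_poly_approximation\<close>).
\<close>

section \<open>Density of trigonometric polynomials\<close>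

text \<open>
  The phase \<open>a\<close> makes one kind of generator enough: it covers sine, cosine and, with
  \<open>u = 0\<close>, the constants.
\<close>

inductive trig_poly :: "(real \<Rightarrow> real) \<Rightarrow> bool" where
  wave: "trig_poly (\<lambda>x. cos (u * x + a))"
| add: "trig_poly p \<Longrightarrow> trig_poly q \<Longrightarrow> trig_poly (\<lambda>x. p x + q x)"
| scale: "trig_poly p \<Longrightarrow> trig_poly (\<lambda>x. c * p x)"

lemma trig_poly_const: "trig_poly (\<lambda>x. c)"
  using trig_poly.scale[OF trig_poly.wave[of 0 0], of c] by simp

lemma trig_poly_mult:
  assumes "trig_poly p" "trig_poly q"
  shows "trig_poly (\<lambda>x. p x * q x)"
  using assms
proof (induction arbitrary: q)
  case (wave u a)
  from wave show ?case
  proof induction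
    case (wave v b)
    have "(\<lambda>x. cos (u * x + a) * cos (v * x + b)) =
      (\<lambda>x. 1/2 * cos ((u - v) * x + (a - b)) + 1/2 * cos ((u + v) * x + (a + b)))"
      by (simp add: cos_times_cos fun_eq_iff algebra_simps add_divide_distrib)
    then show ?case
      by (simp only:) (intro trig_poly.intros)
  next
    case (add p q)
    then show ?case by (simp add: distrib_left trig_poly.add)
  next
    case (scale p c)
    then show ?case by (simp add: mult.left_commute trig_poly.scale)
  qed
next
  case (add p1 p2)
  then show ?case by (simp add: distrib_right trig_poly.add)
next
  case (scale p c)
  then show ?case by (simp add: mult.assoc trig_poly.scale)
qed

text \<open>
  The sine is a wave with phase \<open>- pi / 2\<close>, and trigonometric polynomials form an algebra.
\<close>

lemma trig_poly_polynomial_sin: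
  fixes p :: "real \<Rightarrow> real"
  assumes "real_polynomial_function p"
  shows "trig_poly (\<lambda>x. p (sin (w * x)))"
  using assms
proof induction
  case (linear l)
  interpret bounded_linear l by fact
  have l: "l y = l 1 * y" for y
    using scaleR[of y 1] by simp
  have "l (sin (w * x)) = l 1 * cos (w * x + - (pi / 2))" for x
    unfolding l[of "sin (w * x)"] by (simp add: cos_add del: add_uminus_conv_diff)
  then show ?case
    by (simp only:) (intro trig_poly.intros)
next
  case (const c)
  show ?case by (rule trig_poly_const)
next
  case (add p q)
  then show ?case by (intro trig_poly.add)
next
  case (mult p q)
  then show ?case by (intro trig_poly_mult)
qed

lemma trig_poly_continuous: "trig_poly p \<Longrightarrow> continuous_on UNIV p"
  by (induction rule: trig_poly.induct) (auto intro!: continuous_intros)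

lemma trig_poly_bounded: "trig_poly p \<Longrightarrow> \<exists>B. \<forall>x. \<bar>p x\<bar> \<le> B"
proof (induction rule: trig_poly.induct)
  case (wave u a)
  then show ?case by (intro exI[of _ 1]) auto
next
  case (add p q)
  then obtain B C where "\<forall>x. \<bar>p x\<bar> \<le> B" "\<forall>x. \<bar>q x\<bar> \<le> C" by blast
  then show ?case
    by (intro exI[of _ "B + C"]) (meson abs_triangle_ineq add_mono order_trans)
next
  case (scale p c)
  then obtain B where "\<forall>x. \<bar>p x\<bar> \<le> B" by blast
  then show ?case
    by (intro exI[of _ "\<bar>c\<bar> * B"]) (auto simp: abs_mult intro: mult_left_mono)
qed

text \<open>
  The map \<open>x \<mapsto> sin (pi x / (2 L))\<close> is a homeomorphism from \<open>[-L, L]\<close> to \<open>[-1, 1]\<close>, so there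
  \<open>f\<close> is a continuous function of the sine and the Weierstrass theorem applies. The same
  polynomial in the sine is defined on the whole line, and outside \<open>[-L, L]\<close> it only repeats the
  values that it takes inside; this gives the last conclusion, a global bound on \<open>p\<close>.
\<close>

lemma trig_poly_approximation:
  fixes f :: "real \<Rightarrow> real"
  assumes cont: "continuous_on UNIV f" and e: "e > 0" and L: "L > 0"
  obtains p where "trig_poly p" "\<And>x. \<bar>x\<bar> \<le> L \<Longrightarrow> \<bar>f x - p x\<bar> \<le> e"
    "\<And>x. \<exists>y. \<bar>y\<bar> \<le> L \<and> \<bar>p x\<bar> \<le> \<bar>f y\<bar> + e"
proof -
  define g where "g s = f (2 * L / pi * arcsin s)" for s
  define w where "w = pi / (2 * L)"
  have "continuous_on {-1..1} (\<lambda>s. 2 * L / pi * arcsin s)"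
    by (intro continuous_intros) auto
  from continuous_on_compose[OF this continuous_on_subset[OF cont]]
  have "continuous_on {-1..1} g"
    by (simp add: g_def o_def)
  then obtain r where r: "real_polynomial_function r"
    "\<And>s. s \<in> {-1..1} \<Longrightarrow> \<bar>g s - r s\<bar> < e"
    using Stone_Weierstrass_real_polynomial_function[of "{-1..1}" g e] e by auto
  \<comment> \<open>\<open>y x\<close> is the point of \<open>[-L, L]\<close> at which the sine takes the same value as at \<open>x\<close>.\<close>
  define y where "y x = 2 * L / pi * arcsin (sin (w * x))" for x
  have near: "\<bar>f (y x) - r (sin (w * x))\<bar> \<le> e" for x
    using r(2)[of "sin (w * x)"] by (simp add: g_def y_def)
  have y_le: "\<bar>y x\<bar> \<le> L" for x
  proof -
    have "\<bar>arcsin (sin (w * x))\<bar> \<le> pi / 2"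
      using arcsin_lbound[of "sin (w * x)"] arcsin_ubound[of "sin (w * x)"] by simp
    then have "2 * L / pi * \<bar>arcsin (sin (w * x))\<bar> \<le> 2 * L / pi * (pi / 2)"
      using L by (intro mult_left_mono) auto
    then show ?thesis using L by (simp add: y_def abs_mult)
  qed
  have y_id: "y x = x" if "\<bar>x\<bar> \<le> L" for x
  proof -
    have "w * L = pi / 2" "w > 0" using L by (simp_all add: w_def)
    moreover have "\<bar>w * x\<bar> \<le> w * L"
      using that \<open>w > 0\<close> by (simp add: abs_mult)
    ultimately have "arcsin (sin (w * x)) = w * x"
      by (intro arcsin_sin) linarith+
    then show ?thesis using L by (simp add: y_def w_def)
  qed
  show thesis
  proof
    show "trig_poly (\<lambda>x. r (sin (w * x)))"
      by (rule trig_poly_polynomial_sin) fact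
    show "\<bar>f x - r (sin (w * x))\<bar> \<le> e" if "\<bar>x\<bar> \<le> L" for x
      using near[of x] y_id[OF that] by simp
    show "\<exists>y. \<bar>y\<bar> \<le> L \<and> \<bar>r (sin (w * x))\<bar> \<le> \<bar>f y\<bar> + e" for x
      using near[of x] y_le[of x] by (intro exI[of _ "y x"]) auto
  qed
qed

text \<open>
  Choose an interval \<open>[-m, m]\<close> that carries almost all of the \<open>\<nu>\<close>-integral of \<open>G\<close>. Outside it the
  approximant is bounded by the values of \<open>f\<close> inside, and so, up to the error, by \<open>G\<close> at the
  nearer point; monotonicity of \<open>G\<close> turns this into a bound by \<open>G\<close> itself.
\<close>

lemma trig_poly_dense_L1:
  fixes f G :: "real \<Rightarrow> real"
  assumes \<nu>: "prob_space \<nu>" "sets \<nu> = sets borel"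
    and f: "continuous_on UNIV f" "\<And>x. \<bar>f x\<bar> \<le> G x"
    and G: "integrable \<nu> G" "\<And>x y. \<bar>x\<bar> \<le> \<bar>y\<bar> \<Longrightarrow> G x \<le> G y"
    and e: "e > 0"
  obtains p where "trig_poly p" "(\<integral>x. \<bar>f x - p x\<bar> \<partial>\<nu>) \<le> e"
proof -
  interpret prob_space \<nu> by fact
  have [measurable_cong]: "sets \<nu> = sets borel" by fact
  have Gm[measurable]: "G \<in> borel_measurable borel"
    using borel_measurable_integrable[OF G(1)] measurable_cong_sets[OF \<nu>(2) refl, of borel] by simp
  have fm[measurable]: "f \<in> borel_measurable borel"
    using f(1) by (simp add: borel_measurable_continuous_onI)
  have G_ge: "0 \<le> G x" for x using f(2)[of x] abs_ge_zero order_trans by blast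
  have "(\<lambda>m. \<integral>x. G x * indicator {x. real m < \<bar>x\<bar>} x \<partial>\<nu>) \<longlonglongrightarrow> (\<integral>x. 0 \<partial>\<nu>)"
  proof (rule integral_dominated_convergence[where w = G])
    show "AE x in \<nu>. (\<lambda>m. G x * indicator {x. real m < \<bar>x\<bar>} x) \<longlonglongrightarrow> 0"
    proof (rule AE_I2)
      fix x :: real
      obtain N where N: "\<bar>x\<bar> \<le> real N" using real_arch_simple by blast
      have "G x * indicator {x. real m < \<bar>x\<bar>} x = 0" if "m \<ge> N" for m
        using that N by (auto simp: indicator_def)
      then show "(\<lambda>m. G x * indicator {x. real m < \<bar>x\<bar>} x) \<longlonglongrightarrow> 0"
        by (intro tendsto_eventually eventually_sequentiallyI[of N]) 
    qed
  qed (use G_ge G(1) in \<open>auto simp: indicator_def\<close>)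
  then have "\<forall>\<^sub>F m in sequentially. (\<integral>x. G x * indicator {x. real m < \<bar>x\<bar>} x \<partial>\<nu>) < e / 4"
    using e by (intro order_tendstoD) auto
  then have "\<forall>\<^sub>F m in sequentially. m > 0 \<and> (\<integral>x. G x * indicator {x. real m < \<bar>x\<bar>} x \<partial>\<nu>) < e / 4"
    using eventually_gt_at_top[of "0::nat"] by eventually_elim auto
  then obtain m :: nat where m: "m > 0" "(\<integral>x. G x * indicator {x. real m < \<bar>x\<bar>} x \<partial>\<nu>) < e / 4"
    using eventually_happens'[OF sequentially_bot] by blast
  obtain p where p: "trig_poly p" "\<And>x. \<bar>x\<bar> \<le> real m \<Longrightarrow> \<bar>f x - p x\<bar> \<le> e / 2"
    "\<And>x. \<exists>y. \<bar>y\<bar> \<le> real m \<and> \<bar>p x\<bar> \<le> \<bar>f y\<bar> + e / 2"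
    using trig_poly_approximation[OF f(1), of "e / 2" "real m"] e m(1) by auto
  have pm[measurable]: "p \<in> borel_measurable borel"
    using trig_poly_continuous[OF p(1)] by (simp add: borel_measurable_continuous_onI)
  have bound: "\<bar>f x - p x\<bar> \<le> e / 2 + 2 * (G x * indicator {x. real m < \<bar>x\<bar>} x)" for x
  proof (cases "\<bar>x\<bar> \<le> real m")
    case True
    then show ?thesis using p(2)[of x] by simp
  next
    case False
    obtain y where y: "\<bar>y\<bar> \<le> real m" "\<bar>p x\<bar> \<le> \<bar>f y\<bar> + e / 2" using p(3) by blast
    have "G y \<le> G x" using False y(1) by (intro G(2)) auto
    then show ?thesis using False y(2) f(2)[of x] f(2)[of y] by auto
  qed
  have intG: "integrable \<nu> (\<lambda>x. G x * indicator {x. real m < \<bar>x\<bar>} x)"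
    by (rule Bochner_Integration.integrable_bound[OF G(1)]) (auto simp: indicator_def)
  have "(\<integral>x. \<bar>f x - p x\<bar> \<partial>\<nu>) \<le> (\<integral>x. e / 2 + 2 * (G x * indicator {x. real m < \<bar>x\<bar>} x) \<partial>\<nu>)"
    using bound e G_ge intG by (intro integral_mono') (auto intro!: add_nonneg_nonneg)
  also have "\<dots> = e / 2 + 2 * (\<integral>x. G x * indicator {x. real m < \<bar>x\<bar>} x \<partial>\<nu>)"
    using intG by (simp add: prob_space)
  also have "\<dots> \<le> e" using m(2) by simp
  finally show thesis using p(1) that by blast
qed

section \<open>The law of large numbers in mean for arrays with identical margins\<close>

text \<open>
  Rows are infinite, which spares side conditions on the index; the average in row \<open>n\<close> uses the
  first \<open>n\<close> entries.
\<close>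

locale identically_distributed_array = prob_space M for M :: "'a measure" +
  fixes W :: "nat \<Rightarrow> nat \<Rightarrow> 'a \<Rightarrow> real" and \<nu> :: "real measure"
  assumes W_measurable [measurable]: "W n i \<in> borel_measurable M"
    and distr_W: "distr M borel (W n i) = \<nu>"
begin

definition dev :: "(real \<Rightarrow> real) \<Rightarrow> nat \<Rightarrow> 'a \<Rightarrow> real" where
  "dev g n \<omega> = (\<Sum>i<n. g (W n i \<omega>)) / real n - (\<integral>x. g x \<partial>\<nu>)"

definition lln :: "(real \<Rightarrow> real) \<Rightarrow> bool" where
  "lln g \<longleftrightarrow> (\<lambda>n. expectation (\<lambda>\<omega>. \<bar>dev g n \<omega>\<bar>)) \<longlonglongrightarrow> 0"

lemma sets_nu [measurable_cong, simp]: "sets \<nu> = sets borel"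
  using distr_W[of 0 0] by (metis sets_distr)

lemma prob_space_nu: "prob_space \<nu>"
  using prob_space_distr[OF W_measurable[of 0 0]] distr_W[of 0 0] by simp

lemma integrable_W: "integrable \<nu> (g :: real \<Rightarrow> real) \<Longrightarrow> integrable M (\<lambda>\<omega>. g (W n i \<omega>))"
  unfolding distr_W[of n i, symmetric] by (rule integrable_distr[OF W_measurable])

lemma expectation_W:
  assumes "integrable \<nu> (g :: real \<Rightarrow> real)"
  shows "expectation (\<lambda>\<omega>. g (W n i \<omega>)) = (\<integral>x. g x \<partial>\<nu>)"
proof -
  have "g \<in> borel_measurable borel"
    using borel_measurable_integrable[OF assms] measurable_cong_sets[OF sets_nu refl, of borel] by simp
  then show ?thesis
    unfolding distr_W[of n i, symmetric] by (subst integral_distr) auto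
qed

lemma expectation_average:
  assumes "integrable \<nu> (g :: real \<Rightarrow> real)" "n > 0"
  shows "expectation (\<lambda>\<omega>. (\<Sum>i<n. g (W n i \<omega>)) / real n) = (\<integral>x. g x \<partial>\<nu>)"
  using assms by (simp add: integrable_W expectation_W)

lemma integrable_dev: "integrable \<nu> g \<Longrightarrow> integrable M (dev g n)"
  unfolding dev_def by (simp add: integrable_W)

lemma lln_add:
  assumes "lln g" "lln k" and int: "integrable \<nu> g" "integrable \<nu> k"
  shows "lln (\<lambda>x. g x + k x)"
  unfolding lln_def
proof (rule tendsto_sandwich[where f = "\<lambda>_. 0"])
  show "(\<lambda>n. expectation (\<lambda>\<omega>. \<bar>dev g n \<omega>\<bar>) + expectation (\<lambda>\<omega>. \<bar>dev k n \<omega>\<bar>)) \<longlonglongrightarrow> 0"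
    using tendsto_add[OF assms(1,2)[unfolded lln_def]] by simp
  have "expectation (\<lambda>\<omega>. \<bar>dev (\<lambda>x. g x + k x) n \<omega>\<bar>) \<le>
        expectation (\<lambda>\<omega>. \<bar>dev g n \<omega>\<bar>) + expectation (\<lambda>\<omega>. \<bar>dev k n \<omega>\<bar>)" for n
  proof -
    have "dev (\<lambda>x. g x + k x) n \<omega> = dev g n \<omega> + dev k n \<omega>" for \<omega>
      using int by (simp add: dev_def sum.distrib add_divide_distrib)
    then have "expectation (\<lambda>\<omega>. \<bar>dev (\<lambda>x. g x + k x) n \<omega>\<bar>) \<le>
        expectation (\<lambda>\<omega>. \<bar>dev g n \<omega>\<bar> + \<bar>dev k n \<omega>\<bar>)"
      by (intro integral_mono') (auto intro!: Bochner_Integration.integrable_add Bochner_Integration.integrable_abs integrable_dev int)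
    also have "\<dots> = expectation (\<lambda>\<omega>. \<bar>dev g n \<omega>\<bar>) + expectation (\<lambda>\<omega>. \<bar>dev k n \<omega>\<bar>)"
      by (intro Bochner_Integration.integral_add Bochner_Integration.integrable_abs integrable_dev int)
    finally show ?thesis .
  qed
  then show "\<forall>\<^sub>F n in sequentially. expectation (\<lambda>\<omega>. \<bar>dev (\<lambda>x. g x + k x) n \<omega>\<bar>) \<le>
        expectation (\<lambda>\<omega>. \<bar>dev g n \<omega>\<bar>) + expectation (\<lambda>\<omega>. \<bar>dev k n \<omega>\<bar>)" by simp
qed auto

lemma lln_scale:
  assumes "lln g"
  shows "lln (\<lambda>x. c * g x)"
proof -
  have "dev (\<lambda>x. c * g x) n \<omega> = c * dev g n \<omega>" for n \<omega>
    by (simp add: dev_def sum_distrib_left[symmetric] right_diff_distrib)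
  then have "expectation (\<lambda>\<omega>. \<bar>dev (\<lambda>x. c * g x) n \<omega>\<bar>) = \<bar>c\<bar> * expectation (\<lambda>\<omega>. \<bar>dev g n \<omega>\<bar>)" for n
    by (simp add: abs_mult)
  then show ?thesis
    using tendsto_mult_left[OF assms[unfolded lln_def], of "\<bar>c\<bar>"] by (simp add: lln_def)
qed

text \<open>
  Since all margins agree, an empirical mean of \<open>|g - p|\<close> has the expectation of a single term, so
  exchanging \<open>g\<close> for \<open>p\<close> changes the deviation by at most \<open>2 \<integral> |g - p|\<close> in mean.
\<close>

lemma lln_L1_closed:
  assumes g: "integrable \<nu> g"
    and approx: "\<And>e. e > 0 \<Longrightarrow> \<exists>p. lln p \<and> integrable \<nu> p \<and> (\<integral>x. \<bar>g x - p x\<bar> \<partial>\<nu>) \<le> e"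
  shows "lln g"
  unfolding lln_def
proof (rule LIMSEQ_I)
  fix r :: real assume r: "0 < r"
  obtain p where p: "lln p" "integrable \<nu> p" "(\<integral>x. \<bar>g x - p x\<bar> \<partial>\<nu>) \<le> r / 4"
    using approx[of "r / 4"] r by auto
  let ?d = "\<lambda>x. \<bar>g x - p x\<bar>"
  have d: "integrable \<nu> ?d" using g p(2) by auto
  have "\<forall>\<^sub>F n in sequentially. expectation (\<lambda>\<omega>. \<bar>dev p n \<omega>\<bar>) < r / 4"
    using p(1) r unfolding lln_def by (intro order_tendstoD) auto
  then have "\<forall>\<^sub>F n in sequentially. norm (expectation (\<lambda>\<omega>. \<bar>dev g n \<omega>\<bar>) - 0) < r"
    using eventually_gt_at_top[of 0]
  proof eventually_elim
    case (elim n)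
    have "\<bar>dev g n \<omega>\<bar> \<le> \<bar>dev p n \<omega>\<bar> + ((\<Sum>i<n. ?d (W n i \<omega>)) / real n + (\<integral>x. ?d x \<partial>\<nu>))" for \<omega>
    proof -
      have "\<bar>(\<Sum>i<n. g (W n i \<omega>)) / real n - (\<Sum>i<n. p (W n i \<omega>)) / real n\<bar> \<le> (\<Sum>i<n. ?d (W n i \<omega>)) / real n"
        by (simp add: diff_divide_distrib[symmetric] sum_subtractf[symmetric] divide_right_mono sum_abs)
      moreover have "\<bar>(\<integral>x. g x \<partial>\<nu>) - (\<integral>x. p x \<partial>\<nu>)\<bar> \<le> (\<integral>x. ?d x \<partial>\<nu>)"
        using g p(2) integral_abs_bound[of \<nu> "\<lambda>x. g x - p x"] by simp
      ultimately show ?thesis by (simp add: dev_def)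
    qed
    moreover have i: "integrable M (\<lambda>\<omega>. (\<Sum>i<n. ?d (W n i \<omega>)) / real n)"
      by (intro Bochner_Integration.integrable_divide Bochner_Integration.integrable_sum integrable_W[OF d])
    moreover have "integrable M (\<lambda>\<omega>. \<bar>dev p n \<omega>\<bar>)"
      by (intro Bochner_Integration.integrable_abs integrable_dev p)
    ultimately have "expectation (\<lambda>\<omega>. \<bar>dev g n \<omega>\<bar>) \<le>
        expectation (\<lambda>\<omega>. \<bar>dev p n \<omega>\<bar> + ((\<Sum>i<n. ?d (W n i \<omega>)) / real n + (\<integral>x. ?d x \<partial>\<nu>)))"
      by (intro integral_mono' Bochner_Integration.integrable_add)
         (auto intro!: add_nonneg_nonneg divide_nonneg_nonneg sum_nonneg)
    also have "\<dots> = expectation (\<lambda>\<omega>. \<bar>dev p n \<omega>\<bar>) + 2 * (\<integral>x. ?d x \<partial>\<nu>)"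
      using i integrable_dev[OF p(2)] expectation_average[OF d elim(2)] by (simp add: prob_space)
    also have "\<dots> < r" using elim p(3) r by simp
    finally show ?case by simp
  qed
  then show "\<exists>no. \<forall>n\<ge>no. norm (expectation (\<lambda>\<omega>. \<bar>dev g n \<omega>\<bar>) - 0) < r"
    by (simp add: eventually_sequentially)
qed

text \<open>
  The functions that obey the law form a subspace closed in \<open>L\<^sup>1(\<nu>)\<close>, and the waves span
  a dense one.
\<close>

lemma lln_continuous_if_lln_waves:
  assumes waves: "\<And>u a. lln (\<lambda>x. cos (u * x + a))"
    and f: "continuous_on UNIV f" "\<And>x. \<bar>f x\<bar> \<le> G x"
    and G: "integrable \<nu> G" "\<And>x y. \<bar>x\<bar> \<le> \<bar>y\<bar> \<Longrightarrow> G x \<le> G y"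
  shows "lln f"
proof (rule lln_L1_closed)
  have p_int: "integrable \<nu> p" if p: "trig_poly p" for p
  proof -
    interpret \<nu>: prob_space \<nu> by (rule prob_space_nu)
    have [measurable]: "p \<in> borel_measurable borel"
      using trig_poly_continuous[OF p] by (simp add: borel_measurable_continuous_onI)
    obtain B where "\<forall>x. \<bar>p x\<bar> \<le> B" using trig_poly_bounded[OF p] by blast
    then show ?thesis by (intro \<nu>.integrable_const_bound[of _ B]) auto
  qed
  have p_lln: "lln p" if "trig_poly p" for p
    using that by induction (auto intro: waves lln_add lln_scale p_int)
  have [measurable]: "f \<in> borel_measurable borel"
    using f(1) by (simp add: borel_measurable_continuous_onI)
  show "integrable \<nu> f"
    by (rule Bochner_Integration.integrable_bound[OF G(1)]) (auto intro!: AE_I2 order_trans[OF f(2)])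
  show "\<exists>p. lln p \<and> integrable \<nu> p \<and> (\<integral>x. \<bar>f x - p x\<bar> \<partial>\<nu>) \<le> e" if "e > 0" for e
    using trig_poly_dense_L1[OF prob_space_nu sets_nu f G that] p_int p_lln by metis
qed

end

section \<open>Gaussian variables and stationary Gaussian processes\<close>

lemma gauss_dens_nonneg: "0 \<le> gauss_dens v z"
  by (simp add: gauss_dens_def)

lemma gauss_dens_measurable [measurable]: "gauss_dens v \<in> borel_measurable borel"
  unfolding gauss_dens_def by measurable

lemma integrable_gauss_dens_poly:
  assumes "v > 0"
  shows "integrable lborel (\<lambda>z. gauss_dens v z * (c * (1 + \<bar>z\<bar> ^ k)))"
proof -
  have "integrable lborel (\<lambda>z. c * gauss_dens v z + c * (gauss_dens v z * \<bar>z\<bar> ^ k))"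
    using integrable_normal_moment_abs[of "sqrt v" 0 k] integrable_normal_density[of "sqrt v" 0] assms
    unfolding gauss_dens_def by simp
  then show ?thesis by (simp add: algebra_simps)
qed

lemma integrable_gauss_dens_scaleR:
  fixes f :: "real \<Rightarrow> 'v :: euclidean_space"
  assumes "v > 0" and [measurable]: "f \<in> borel_measurable borel"
    and bound: "\<And>z. norm (f z) \<le> c * (1 + \<bar>z\<bar> ^ k)"
  shows "integrable lborel (\<lambda>z. gauss_dens v z *\<^sub>R f z)"
proof (rule Bochner_Integration.integrable_bound[OF integrable_gauss_dens_poly[OF assms(1), of c k]])
  show "AE z in lborel. norm (gauss_dens v z *\<^sub>R f z) \<le> norm (gauss_dens v z * (c * (1 + \<bar>z\<bar> ^ k)))"
  proof (rule AE_I2)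
    fix z
    have "norm (f z) \<le> \<bar>c * (1 + \<bar>z\<bar> ^ k)\<bar>" using bound[of z] by linarith
    then show "norm (gauss_dens v z *\<^sub>R f z) \<le> norm (gauss_dens v z * (c * (1 + \<bar>z\<bar> ^ k)))"
      by (simp add: gauss_dens_nonneg abs_mult mult_left_mono)
  qed
qed simp

context prob_space
begin

lemma gaussian_rv_square_integrable:
  assumes "gaussian_rv M W"
  shows "integrable M (\<lambda>\<omega>. (W \<omega>)\<^sup>2)"
proof -
  have [measurable]: "W \<in> borel_measurable M"
    using assms by (simp add: gaussian_rv_def)
  consider (normal) m s where "0 < s" "distributed M lborel W (\<lambda>x. ennreal (normal_density m s x))"
    | (degenerate) m where "AE \<omega> in M. W \<omega> = m"
    using assms by (auto simp: gaussian_rv_def)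
  then show ?thesis
  proof cases
    case normal
    have "integrable lborel (\<lambda>x. normal_density m s x * (x - m)\<^sup>2 + 2 * m * (normal_density m s x * (x - m) ^ 1)
        + m\<^sup>2 * normal_density m s x)"
      using integrable_normal_moment[OF normal(1), of m 2] integrable_normal_moment[OF normal(1), of m 1]
        integrable_normal_density[OF normal(1), of m]
      by (intro Bochner_Integration.integrable_add Bochner_Integration.integrable_mult_right)
    also have "(\<lambda>x. normal_density m s x * (x - m)\<^sup>2 + 2 * m * (normal_density m s x * (x - m) ^ 1)
        + m\<^sup>2 * normal_density m s x) = (\<lambda>x. normal_density m s x * x\<^sup>2)"
      by (simp add: fun_eq_iff power2_eq_square algebra_simps)
    finally show ?thesis
      using distributed_integrable[OF normal(2), of "\<lambda>x. x\<^sup>2"] by simp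
  next
    case degenerate
    then have "integrable M (\<lambda>\<omega>. (W \<omega>)\<^sup>2) \<longleftrightarrow> integrable M (\<lambda>\<omega>. m\<^sup>2)"
      by (intro integrable_cong_AE) auto
    then show ?thesis by simp
  qed
qed

lemma integrable_if_square_integrable:
  assumes [measurable]: "W \<in> borel_measurable M" and "integrable M (\<lambda>\<omega>. (W \<omega>)\<^sup>2)"
  shows "integrable M (W :: 'a \<Rightarrow> real)"
proof (rule Bochner_Integration.integrable_bound[of M "\<lambda>\<omega>. 1 + (W \<omega>)\<^sup>2"])
  have "\<bar>x\<bar> \<le> 1 + x\<^sup>2" for x :: real
    using zero_le_power2[of "\<bar>x\<bar> - 1"] by (auto simp: power2_eq_square algebra_simps)
  then show "AE \<omega> in M. norm (W \<omega>) \<le> norm (1 + (W \<omega>)\<^sup>2)"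
    by (auto intro!: AE_I2 simp: abs_of_nonneg)
qed (use assms in auto)

text \<open>
  The variance decides between the two alternatives in the definition of a Gaussian variable, which
  has to be kept general: sums and differences such as \<open>Z\<^sub>t - Z\<^sub>t\<close> may be degenerate.
\<close>

lemma centered_gaussian_rv_cases:
  assumes W: "gaussian_rv M W" and mean: "expectation W = 0" and var: "expectation (\<lambda>\<omega>. (W \<omega>)\<^sup>2) = v"
  obtains (normal) "v > 0" "distributed M lborel W (\<lambda>x. ennreal (gauss_dens v x))"
    | (degenerate) "v = 0" "AE \<omega> in M. W \<omega> = 0"
proof -
  have [measurable]: "W \<in> borel_measurable M"
    using W by (simp add: gaussian_rv_def)
  consider (N) m s where "0 < s" "distributed M lborel W (\<lambda>x. ennreal (normal_density m s x))"
    | (D) m where "AE \<omega> in M. W \<omega> = m"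
    using W by (auto simp: gaussian_rv_def)
  then show thesis
  proof cases
    case N
    have "m = 0" using normal_distributed_expectation[OF N] mean by simp
    moreover have "s\<^sup>2 = v" using normal_distributed_variance[OF N] mean var by simp
    ultimately show thesis using N that(1)
      by (auto simp: gauss_dens_def real_sqrt_abs)
  next
    case D
    have "expectation W = expectation (\<lambda>_. m)" using D by (intro integral_cong_AE) auto
    then have "m = 0" using mean by (simp add: prob_space)
    moreover have "expectation (\<lambda>\<omega>. (W \<omega>)\<^sup>2) = expectation (\<lambda>_. m\<^sup>2)"
      using D by (intro integral_cong_AE) auto
    ultimately show thesis using D var that(2) by simp
  qed
qed

text \<open>
  Real part of the characteristic function of the centered normal law, turned by the phase \<open>c\<close>.
\<close>

lemma expectation_cos_gaussian:
  assumes W: "gaussian_rv M W" and mean: "expectation W = 0" and var: "expectation (\<lambda>\<omega>. (W \<omega>)\<^sup>2) = v"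
  shows "expectation (\<lambda>\<omega>. cos (W \<omega> + c)) = exp (- v / 2) * cos c"
  using assms
proof (cases rule: centered_gaussian_rv_cases)
  case degenerate
  have [measurable]: "W \<in> borel_measurable M"
    using W by (simp add: gaussian_rv_def)
  have "expectation (\<lambda>\<omega>. cos (W \<omega> + c)) = expectation (\<lambda>_. cos c)"
    using degenerate(2) by (intro integral_cong_AE) auto
  then show ?thesis using degenerate(1) by (simp add: prob_space)
next
  case normal
  have [measurable]: "W \<in> borel_measurable M"
    using W by (simp add: gaussian_rv_def)
  define S where "S \<omega> = W \<omega> / sqrt v" for \<omega>
  have "distributed M lborel S std_normal_density"
    using normal normal_standard_normal_convert[of "sqrt v" W 0]
    unfolding S_def gauss_dens_def by simp
  then have S: "distr M lborel S = std_normal_distribution"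
    by (simp add: distributed_distr_eq_density)
  have [measurable]: "S \<in> borel_measurable M" unfolding S_def by measurable
  have "complex_of_real (exp (- v / 2)) = char std_normal_distribution (sqrt v)"
    using normal(1) by (simp add: char_std_normal_distribution)
  also have "\<dots> = (CLINT \<omega>|M. iexp (sqrt v * S \<omega>))"
    unfolding char_def S[symmetric] by (subst integral_distr) auto
  also have "\<dots> = (CLINT \<omega>|M. iexp (W \<omega>))"
    using normal(1) by (simp add: S_def)
  finally have char: "(CLINT \<omega>|M. iexp (W \<omega>)) = complex_of_real (exp (- v / 2))" ..
  have int: "integrable M (\<lambda>\<omega>. iexp (W \<omega>) * iexp c)"
    by (intro integrable_const_bound[of _ 1]) (auto simp: norm_mult)
  have "expectation (\<lambda>\<omega>. cos (W \<omega> + c)) = expectation (\<lambda>\<omega>. Re (iexp (W \<omega>) * iexp c))"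
    by (simp add: exp_add[symmetric] distrib_left[symmetric] Re_exp)
  also have "\<dots> = Re (CLINT \<omega>|M. iexp (W \<omega>) * iexp c)"
    by (rule integral_Re[OF int])
  also have "\<dots> = Re (complex_of_real (exp (- v / 2)) * iexp c)"
    using char by simp
  also have "\<dots> = exp (- v / 2) * cos c" by (simp add: Re_exp)
  finally show ?thesis .
qed

lemma centered_gaussian_distr:
  assumes "gaussian_rv M W" "expectation W = 0" "expectation (\<lambda>\<omega>. (W \<omega>)\<^sup>2) = v" "v > 0"
  shows "distr M borel W = density lborel (\<lambda>x. ennreal (gauss_dens v x))"
  using assms(1-3)
proof (cases rule: centered_gaussian_rv_cases)
  case normal
  have "distr M borel W = distr M lborel W" by (rule distr_cong) auto
  then show ?thesis using normal(2) by (simp add: distributed_distr_eq_density)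
qed (use assms in auto)

end

locale stationary_gaussian_process = prob_space M for M :: "'a measure" +
  fixes k :: "real \<Rightarrow> real" and Z :: "real \<Rightarrow> 'a \<Rightarrow> real"
  assumes stationary_gaussian: "centered_stationary_gaussian M k Z"
begin

text \<open>
  The hypothesis speaks of sums over sets of times, so coinciding times are treated separately.
\<close>

lemma gaussian_combination:
  assumes "s \<ge> 0" "t \<ge> 0"
  shows "gaussian_rv M (\<lambda>\<omega>. \<alpha> * Z s \<omega> + \<beta> * Z t \<omega>)"
proof -
  have *: "gaussian_rv M (\<lambda>\<omega>. \<Sum>r\<in>I. a r * Z r \<omega>)" if "finite I" "I \<subseteq> {0..}" for I a
    using stationary_gaussian that
    by (auto simp: centered_stationary_gaussian_def gaussian_process_def)
  show ?thesis
  proof (cases "s = t")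
    case True
    then show ?thesis using *[of "{s}" "\<lambda>_. \<alpha> + \<beta>"] assms by (simp add: distrib_right)
  next
    case False
    then show ?thesis using *[of "{s, t}" "\<lambda>r. if r = s then \<alpha> else \<beta>"] assms by simp
  qed
qed

lemma gaussian_Z: "t \<ge> 0 \<Longrightarrow> gaussian_rv M (Z t)"
  using gaussian_combination[of t t 1 0] by simp

lemma Z_measurable: "t \<ge> 0 \<Longrightarrow> Z t \<in> borel_measurable M"
  using gaussian_Z by (simp add: gaussian_rv_def)

lemma integrable_Z: "t \<ge> 0 \<Longrightarrow> integrable M (Z t)"
  by (rule integrable_if_square_integrable[OF Z_measurable gaussian_rv_square_integrable[OF gaussian_Z]])

lemma integrable_Z_times_Z:
  assumes "s \<ge> 0" "t \<ge> 0"
  shows "integrable M (\<lambda>\<omega>. Z s \<omega> * Z t \<omega>)"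
proof -
  have "integrable M (\<lambda>\<omega>. ((1 * Z s \<omega> + 1 * Z t \<omega>)\<^sup>2 - (Z s \<omega>)\<^sup>2 - (Z t \<omega>)\<^sup>2) / 2)"
    by (intro Bochner_Integration.integrable_divide Bochner_Integration.integrable_diff
        gaussian_rv_square_integrable gaussian_combination gaussian_Z assms)
  then show ?thesis by (simp add: power2_sum)
qed

lemma expectation_Z: "t \<ge> 0 \<Longrightarrow> expectation (Z t) = 0"
  using stationary_gaussian by (simp add: centered_stationary_gaussian_def)

lemma expectation_Z_times_Z: "s \<ge> 0 \<Longrightarrow> t \<ge> 0 \<Longrightarrow> expectation (\<lambda>\<omega>. Z s \<omega> * Z t \<omega>) = k \<bar>s - t\<bar>"
  using stationary_gaussian by (simp add: centered_stationary_gaussian_def)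

lemma expectation_combination:
  assumes "s \<ge> 0" "t \<ge> 0"
  shows "expectation (\<lambda>\<omega>. \<alpha> * Z s \<omega> + \<beta> * Z t \<omega>) = 0"
  using assms by (simp add: integrable_Z expectation_Z)

lemma expectation_combination_square:
  assumes "s \<ge> 0" "t \<ge> 0"
  shows "expectation (\<lambda>\<omega>. (\<alpha> * Z s \<omega> + \<beta> * Z t \<omega>)\<^sup>2) = (\<alpha>\<^sup>2 + \<beta>\<^sup>2) * k 0 + 2 * \<alpha> * \<beta> * k \<bar>s - t\<bar>"
proof -
  have "(\<lambda>\<omega>. (\<alpha> * Z s \<omega> + \<beta> * Z t \<omega>)\<^sup>2) =
    (\<lambda>\<omega>. \<alpha>\<^sup>2 * (Z s \<omega> * Z s \<omega>) + \<beta>\<^sup>2 * (Z t \<omega> * Z t \<omega>) + 2 * \<alpha> * \<beta> * (Z s \<omega> * Z t \<omega>))"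
    by (simp add: fun_eq_iff power2_eq_square algebra_simps)
  then show ?thesis
    using assms by (simp add: integrable_Z_times_Z expectation_Z_times_Z distrib_right)
qed

lemma expectation_square: "t \<ge> 0 \<Longrightarrow> expectation (\<lambda>\<omega>. (Z t \<omega>)\<^sup>2) = k 0"
  using expectation_combination_square[of t t 1 0] by simp

lemma distr_Z:
  assumes "t \<ge> 0" "k 0 > 0"
  shows "distr M borel (Z t) = density lborel (\<lambda>x. ennreal (gauss_dens (k 0) x))"
  using assms by (intro centered_gaussian_distr gaussian_Z expectation_Z expectation_square)

lemma kernel_bound:
  assumes "t \<ge> 0"
  shows "\<bar>k t\<bar> \<le> k 0"
proof -
  \<comment> \<open>The variance of \<open>Z\<^sub>t + \<beta> Z\<^sub>0\<close> is nonnegative for \<open>\<beta> = 1\<close> and \<open>\<beta> = -1\<close>.\<close>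
  have "0 \<le> (1\<^sup>2 + \<beta>\<^sup>2) * k 0 + 2 * 1 * \<beta> * k \<bar>t - 0\<bar>" for \<beta>
    unfolding expectation_combination_square[OF assms order_refl, symmetric]
    by (intro Bochner_Integration.integral_nonneg) auto
  from this[of 1] this[of "-1"] show ?thesis
    using assms by (simp add: abs_le_iff)
qed

lemma expectation_wave:
  assumes "t \<ge> 0"
  shows "expectation (\<lambda>\<omega>. cos (u * Z t \<omega> + a)) = exp (- (u\<^sup>2 * k 0) / 2) * cos a"
  using expectation_cos_gaussian[OF gaussian_combination[of t t u 0] expectation_combination
      expectation_combination_square, of a] assms by simp

text \<open>
  The product-to-sum formula writes the product as waves in \<open>Z\<^sub>s - Z\<^sub>t\<close> and \<open>Z\<^sub>s + Z\<^sub>t\<close>,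
  whose variances are \<open>2 (k 0 - k |s - t|)\<close> and \<open>2 (k 0 + k |s - t|)\<close>. Thus the joint law of
  \<open>Z\<^sub>s\<close> and \<open>Z\<^sub>t\<close> enters only through one-dimensional Gaussian laws.
\<close>

lemma expectation_wave_times_wave:
  assumes "s \<ge> 0" "t \<ge> 0"
  shows "expectation (\<lambda>\<omega>. cos (u * Z s \<omega> + a) * cos (u * Z t \<omega> + a)) =
    (exp (- (u\<^sup>2 * (k 0 - k \<bar>s - t\<bar>))) + exp (- (u\<^sup>2 * (k 0 + k \<bar>s - t\<bar>))) * cos (2 * a)) / 2"
proof -
  have [measurable]: "Z s \<in> borel_measurable M" "Z t \<in> borel_measurable M"
    using assms Z_measurable by auto
  have eq: "expectation (\<lambda>\<omega>. cos (u * Z s \<omega> + \<beta> * Z t \<omega> + c)) =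
     exp (- ((u\<^sup>2 + \<beta>\<^sup>2) * k 0 + 2 * u * \<beta> * k \<bar>s - t\<bar>) / 2) * cos c" for \<beta> c
    by (rule expectation_cos_gaussian[OF gaussian_combination expectation_combination
          expectation_combination_square]) (use assms in auto)
  have int: "integrable M (\<lambda>\<omega>. cos (u * Z s \<omega> + \<beta> * Z t \<omega> + c))" for \<beta> c
    by (intro integrable_const_bound[of _ 1]) auto
  have "expectation (\<lambda>\<omega>. cos (u * Z s \<omega> + a) * cos (u * Z t \<omega> + a)) =
    expectation (\<lambda>\<omega>. (cos (u * Z s \<omega> + (- u) * Z t \<omega> + 0) + cos (u * Z s \<omega> + u * Z t \<omega> + 2 * a)) / 2)"
    by (simp add: cos_times_cos algebra_simps)
  also have "\<dots> = (expectation (\<lambda>\<omega>. cos (u * Z s \<omega> + (- u) * Z t \<omega> + 0)) +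
      expectation (\<lambda>\<omega>. cos (u * Z s \<omega> + u * Z t \<omega> + 2 * a))) / 2"
    using int[of "-u" 0] int[of u "2 * a"] by simp
  also have "\<dots> = (exp (- (u\<^sup>2 * (k 0 - k \<bar>s - t\<bar>))) + exp (- (u\<^sup>2 * (k 0 + k \<bar>s - t\<bar>))) * cos (2 * a)) / 2"
  proof -
    have "- ((u\<^sup>2 + (- u)\<^sup>2) * k 0 + 2 * u * (- u) * k \<bar>s - t\<bar>) / 2 = - (u\<^sup>2 * (k 0 - k \<bar>s - t\<bar>))"
      "- ((u\<^sup>2 + u\<^sup>2) * k 0 + 2 * u * u * k \<bar>s - t\<bar>) / 2 = - (u\<^sup>2 * (k 0 + k \<bar>s - t\<bar>))"
      by (simp_all add: power2_eq_square field_simps)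
    then show ?thesis unfolding eq by simp
  qed
  finally show ?thesis .
qed

end

section \<open>The law of large numbers for a sampled Gaussian process\<close>

lemma card_grid_neighbours:
  fixes \<delta> T :: real
  assumes "\<delta> > 0" "T \<ge> 0"
  shows "real (card {j. j < n \<and> \<bar>real i * \<delta> - real j * \<delta>\<bar> \<le> T}) \<le> 2 * T / \<delta> + 1"
proof -
  define m where "m = nat \<lfloor>T / \<delta>\<rfloor>"
  have "{j. j < n \<and> \<bar>real i * \<delta> - real j * \<delta>\<bar> \<le> T} \<subseteq> {i - m..i + m}"
  proof safe
    fix j assume "\<bar>real i * \<delta> - real j * \<delta>\<bar> \<le> T"
    then have "\<bar>real i - real j\<bar> * \<delta> \<le> T"
      using assms(1) by (simp add: left_diff_distrib[symmetric] abs_mult)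
    then have "real_of_int \<bar>int i - int j\<bar> \<le> T / \<delta>"
      using assms(1) by (simp add: field_simps)
    then have "\<bar>int i - int j\<bar> \<le> \<lfloor>T / \<delta>\<rfloor>"
      by (simp add: le_floor_iff)
    then show "j \<in> {i - m..i + m}"
      by (auto simp: m_def)
  qed
  then have "card {j. j < n \<and> \<bar>real i * \<delta> - real j * \<delta>\<bar> \<le> T} \<le> card {i - m..i + m}"
    by (intro card_mono) auto
  also have "\<dots> \<le> 2 * m + 1" by simp
  finally have "real (card {j. j < n \<and> \<bar>real i * \<delta> - real j * \<delta>\<bar> \<le> T}) \<le> 2 * real m + 1"
    by linarith
  also have "real m \<le> T / \<delta>"
    using assms by (simp add: m_def)
  finally show ?thesis by simp
qed

text \<open>
  Pairs of grid points at distance more than \<open>T\<close> contribute little because \<open>r\<close> is small there. By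
  \<open>card_grid_neighbours\<close> the other pairs have the proportion
  \<open>2 T / (n h\<^sub>n) + 1 / n\<close>, which vanishes since the observation window \<open>n h\<^sub>n\<close> grows.
\<close>

lemma double_mean_tendsto_0:
  fixes r :: "real \<Rightarrow> real"
  assumes h: "\<And>n. h n > 0" "filterlim (\<lambda>n. real n * h n) at_top sequentially"
    and bound: "\<And>t. t \<ge> 0 \<Longrightarrow> \<bar>r t\<bar> \<le> B"
    and lim: "(r \<longlongrightarrow> 0) at_top"
  shows "(\<lambda>n. (\<Sum>i<n. \<Sum>j<n. r \<bar>real i * h n - real j * h n\<bar>) / (real n)\<^sup>2) \<longlonglongrightarrow> 0"
proof (rule LIMSEQ_I)
  fix e :: real assume e: "0 < e"
  have B: "B \<ge> 0" using bound[of 0] by simp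
  have "\<forall>\<^sub>F t in at_top. \<bar>r t\<bar> < e / 2"
    using tendstoD[OF lim, of "e / 2"] e by (simp add: dist_real_def)
  then obtain T0 where T0: "\<And>t. t \<ge> T0 \<Longrightarrow> \<bar>r t\<bar> < e / 2"
    by (auto simp: eventually_at_top_linorder)
  define T where "T = max T0 0"
  have pointwise: "\<bar>r t\<bar> \<le> e / 2 + B * of_bool (t \<le> T)" if "t \<ge> 0" for t
  proof (cases "t \<le> T")
    case True
    then show ?thesis using bound[OF that] e by simp
  next
    case False
    then have "T0 \<le> t" by (simp add: T_def)
    then show ?thesis using T0[of t] False by simp
  qed
  let ?A = "\<lambda>n. (\<Sum>i<n. \<Sum>j<n. r \<bar>real i * h n - real j * h n\<bar>) / (real n)\<^sup>2"
  let ?U = "\<lambda>n. e / 2 + B * (2 * T / (real n * h n) + 1 / real n)"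
  have upper: "\<bar>?A n\<bar> \<le> ?U n" if n: "n > 0" for n
  proof -
    have row: "(\<Sum>j<n. \<bar>r \<bar>real i * h n - real j * h n\<bar>\<bar>) \<le> real n * (e / 2) + B * (2 * T / h n + 1)" for i
    proof -
      have "(\<Sum>j<n. \<bar>r \<bar>real i * h n - real j * h n\<bar>\<bar>)
          \<le> (\<Sum>j<n. e / 2 + B * of_bool (\<bar>real i * h n - real j * h n\<bar> \<le> T))"
        by (intro sum_mono pointwise) simp
      also have "\<dots> = real n * (e / 2) + B * (\<Sum>j<n. of_bool (\<bar>real i * h n - real j * h n\<bar> \<le> T))"
        by (simp add: sum.distrib sum_distrib_left)
      also have "(\<Sum>j<n. of_bool (\<bar>real i * h n - real j * h n\<bar> \<le> T)) =
          real (card {j. j < n \<and> \<bar>real i * h n - real j * h n\<bar> \<le> T})"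
        by (subst sum_of_bool_eq) (auto intro!: arg_cong[where f = card])
      also have "real n * (e / 2) + B * \<dots> \<le> real n * (e / 2) + B * (2 * T / h n + 1)"
        using card_grid_neighbours[of "h n" T n i] h(1)[of n] B
        by (intro add_left_mono mult_left_mono) (auto simp: T_def)
      finally show ?thesis .
    qed
    have "\<bar>\<Sum>i<n. \<Sum>j<n. r \<bar>real i * h n - real j * h n\<bar>\<bar>
        \<le> (\<Sum>i<n. \<Sum>j<n. \<bar>r \<bar>real i * h n - real j * h n\<bar>\<bar>)"
      by (intro order_trans[OF sum_abs] sum_mono sum_abs)
    also have "\<dots> \<le> (\<Sum>i<n. real n * (e / 2) + B * (2 * T / h n + 1))"
      by (intro sum_mono row)
    also have "\<dots> = real n * (real n * (e / 2) + B * (2 * T / h n + 1))" by simp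
    finally have "\<bar>?A n\<bar> \<le> real n * (real n * (e / 2) + B * (2 * T / h n + 1)) / (real n)\<^sup>2"
      by (simp add: divide_right_mono)
    also have "\<dots> = ?U n"
      using n h(1)[of n] by (simp add: field_simps power2_eq_square)
    finally show ?thesis .
  qed
  have "(\<lambda>n. 1 / (real n * h n)) \<longlonglongrightarrow> 0"
    using tendsto_inverse_0_at_top[OF h(2)] by (simp add: divide_inverse)
  then have "(\<lambda>n. e / 2 + B * (2 * T * (1 / (real n * h n)) + 1 / real n)) \<longlonglongrightarrow> e / 2 + B * (2 * T * 0 + 0)"
    by (intro tendsto_intros lim_1_over_n)
  then have "?U \<longlonglongrightarrow> e / 2" by simp
  then have "\<forall>\<^sub>F n in sequentially. ?U n < e"
    using e by (intro order_tendstoD(2)[where y = "e / 2"]) auto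
  then have "\<forall>\<^sub>F n in sequentially. norm (?A n - 0) < e"
    using eventually_gt_at_top[of 0]
  proof eventually_elim
    case (elim n)
    show ?case using upper[OF elim(2)] elim(1) by simp
  qed
  then show "\<exists>no. \<forall>n\<ge>no. norm (?A n - 0) < e"
    by (simp add: eventually_sequentially)
qed

context identically_distributed_array
begin

text \<open>
  The mean square of the deviation is the double mean of the covariances, and it dominates the
  square of the mean absolute deviation.
\<close>

lemma lln_if_covariances_decay:
  assumes g [measurable]: "g \<in> borel_measurable borel" and g_le: "\<And>x. \<bar>g x\<bar> \<le> 1"
    and cov: "\<And>n i j. expectation (\<lambda>\<omega>. g (W n i \<omega>) * g (W n j \<omega>)) - (\<integral>x. g x \<partial>\<nu>)\<^sup>2
      = r \<bar>real i * h n - real j * h n\<bar>"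
    and h: "\<And>n. h n > 0" "filterlim (\<lambda>n. real n * h n) at_top sequentially"
    and r: "\<And>t. t \<ge> 0 \<Longrightarrow> \<bar>r t\<bar> \<le> B" "(r \<longlongrightarrow> 0) at_top"
  shows "lln g"
  unfolding lln_def
proof (rule tendsto_sandwich[where f = "\<lambda>_. 0"])
  let ?V = "\<lambda>n. (\<Sum>i<n. \<Sum>j<n. r \<bar>real i * h n - real j * h n\<bar>) / (real n)\<^sup>2"
  show "(\<lambda>n. sqrt (?V n)) \<longlonglongrightarrow> 0"
    using tendsto_real_sqrt[OF double_mean_tendsto_0[OF h r]] by simp
  interpret \<nu>: prob_space \<nu> by (rule prob_space_nu)
  define m where "m = (\<integral>x. g x \<partial>\<nu>)"
  have g_int: "integrable \<nu> g"
    using g_le by (intro \<nu>.integrable_const_bound[of _ 1]) auto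
  have gg_int: "integrable M (\<lambda>\<omega>. g (W n i \<omega>) * g (W n j \<omega>))" for n i j
    using g_le by (intro integrable_const_bound[of _ 1]) (auto simp: abs_mult intro!: AE_I2 mult_le_one)
  have c_int: "integrable M (\<lambda>\<omega>. (g (W n i \<omega>) - m) * (g (W n j \<omega>) - m))" for n i j
    using gg_int[of n i j] integrable_W[OF g_int]
    by (simp add: left_diff_distrib right_diff_distrib)
  have c_exp: "expectation (\<lambda>\<omega>. (g (W n i \<omega>) - m) * (g (W n j \<omega>) - m)) =
      r \<bar>real i * h n - real j * h n\<bar>" for n i j
  proof -
    have "expectation (\<lambda>\<omega>. (g (W n i \<omega>) - m) * (g (W n j \<omega>) - m)) =
        expectation (\<lambda>\<omega>. g (W n i \<omega>) * g (W n j \<omega>)) - m * m"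
      using gg_int[of n i j] integrable_W[OF g_int] expectation_W[OF g_int]
      by (simp add: left_diff_distrib right_diff_distrib prob_space m_def[symmetric])
    then show ?thesis using cov[of n i j] by (simp add: m_def power2_eq_square)
  qed
  have "expectation (\<lambda>\<omega>. \<bar>dev g n \<omega>\<bar>) \<le> sqrt (?V n)" if n: "n > 0" for n
  proof (rule real_le_rsqrt)
    have dev_sq: "(dev g n \<omega>)\<^sup>2 =
        (\<Sum>i<n. \<Sum>j<n. (g (W n i \<omega>) - m) * (g (W n j \<omega>) - m)) / (real n)\<^sup>2" for \<omega>
    proof -
      have "dev g n \<omega> = (\<Sum>i<n. g (W n i \<omega>) - m) / real n"
        using n by (simp add: dev_def m_def sum_subtractf diff_divide_distrib)
      then show ?thesis
        by (simp add: power_divide power2_eq_square sum_product)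
    qed
    have dev_sq_int: "integrable M (\<lambda>\<omega>. (dev g n \<omega>)\<^sup>2)"
      unfolding dev_sq
      by (intro Bochner_Integration.integrable_divide Bochner_Integration.integrable_sum c_int)
    \<comment> \<open>Cauchy--Schwarz, in the form that the variance of \<open>|dev|\<close> is nonnegative.\<close>
    have "0 \<le> variance (\<lambda>\<omega>. \<bar>dev g n \<omega>\<bar>)"
      by (rule variance_positive)
    also have "\<dots> = expectation (\<lambda>\<omega>. (dev g n \<omega>)\<^sup>2) - (expectation (\<lambda>\<omega>. \<bar>dev g n \<omega>\<bar>))\<^sup>2"
      using integrable_dev[OF g_int] dev_sq_int by (subst variance_eq) auto
    also have "expectation (\<lambda>\<omega>. (dev g n \<omega>)\<^sup>2) = ?V n"
      unfolding dev_sq by (simp add: c_int c_exp)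
    finally show "(expectation (\<lambda>\<omega>. \<bar>dev g n \<omega>\<bar>))\<^sup>2 \<le> ?V n" by simp
  qed
  then show "\<forall>\<^sub>F n in sequentially. expectation (\<lambda>\<omega>. \<bar>dev g n \<omega>\<bar>) \<le> sqrt (?V n)"
    by (intro eventually_sequentiallyI[of 1]) auto
qed auto

end

context stationary_gaussian_process
begin

lemma gaussian_array:
  assumes "k 0 > 0" "\<And>n. h n > 0"
  shows "identically_distributed_array M (\<lambda>n i. Z (real i * h n))
    (density lborel (\<lambda>x. ennreal (gauss_dens (k 0) x)))"
proof (intro identically_distributed_array.intro identically_distributed_array_axioms.intro)
  show "prob_space M" by (rule prob_space_axioms)
  have "0 \<le> real i * h n" for n i using assms(2)[of n] by simp
  then show "Z (real i * h n) \<in> borel_measurable M"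
    "distr M borel (Z (real i * h n)) = density lborel (\<lambda>x. ennreal (gauss_dens (k 0) x))" for n i
    using Z_measurable distr_Z assms(1) by auto
qed

text \<open>
  By \<open>lln_continuous_if_lln_waves\<close> only waves matter, and \<open>expectation_wave_times_wave\<close>
  gives their covariance as a function of the time lag. It vanishes at infinity: as
  \<open>k t\<close> tends to zero, the mean of the product tends to \<open>exp (- u\<^sup>2 k 0) (1 + cos (2 a)) / 2\<close>,
  which is the square of \<open>exp (- u\<^sup>2 k 0 / 2) cos a\<close>.
\<close>

lemma gaussian_lln:
  fixes f :: "real \<Rightarrow> real"
  assumes k: "k 0 > 0" "(k \<longlongrightarrow> 0) at_top"
    and h: "\<And>n. h n > 0" "filterlim (\<lambda>n. real n * h n) at_top sequentially"
    and f: "continuous_on UNIV f" "\<And>x. \<bar>f x\<bar> \<le> c * (1 + \<bar>x\<bar> ^ p)"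
  shows "(\<lambda>n. expectation (\<lambda>\<omega>. \<bar>(\<Sum>i<n. f (Z (real i * h n) \<omega>)) / real n
      - (\<integral>z. gauss_dens (k 0) z * f z \<partial>lborel)\<bar>)) \<longlonglongrightarrow> 0"
proof -
  let ?\<nu> = "density lborel (\<lambda>x. ennreal (gauss_dens (k 0) x))"
  interpret A: identically_distributed_array M "\<lambda>n i. Z (real i * h n)" ?\<nu>
    by (rule gaussian_array) (use k h in auto)
  have t: "0 \<le> real i * h n" for i n using h(1)[of n] by simp
  have waves: "A.lln (\<lambda>x. cos (u * x + a))" for u a
  proof (rule A.lln_if_covariances_decay)
    define m where "m = exp (- (u\<^sup>2 * k 0) / 2) * cos a"
    define r where "r t = (exp (- (u\<^sup>2 * (k 0 - k t))) + exp (- (u\<^sup>2 * (k 0 + k t))) * cos (2 * a)) / 2 - m\<^sup>2" for t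
    have int: "integrable ?\<nu> (\<lambda>x. cos (u * x + a))"
      using A.prob_space_nu by (intro finite_measure.integrable_const_bound[of _ _ 1] prob_space.finite_measure) auto
    have mean: "(\<integral>x. cos (u * x + a) \<partial>?\<nu>) = m"
      using A.expectation_W[OF int, of 0 0] expectation_wave[of 0] by (simp add: m_def)
    show "expectation (\<lambda>\<omega>. cos (u * Z (real i * h n) \<omega> + a) * cos (u * Z (real j * h n) \<omega> + a))
        - (\<integral>x. cos (u * x + a) \<partial>?\<nu>)\<^sup>2 = r \<bar>real i * h n - real j * h n\<bar>" for n i j
      unfolding mean r_def by (subst expectation_wave_times_wave[OF t t]) simp
    show "\<bar>r t\<bar> \<le> 2" if "t \<ge> 0" for t
    proof -
      have *: "0 \<le> u\<^sup>2 * (k 0 - k t)" "0 \<le> u\<^sup>2 * (k 0 + k t)" "0 \<le> u\<^sup>2 * k 0"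
        using kernel_bound[OF that] k(1) by auto
      then have 1: "exp (- (u\<^sup>2 * (k 0 - k t))) \<le> 1" "exp (- (u\<^sup>2 * (k 0 + k t))) \<le> 1"
        "exp (- (u\<^sup>2 * k 0) / 2) \<le> 1" by simp_all
      have "\<bar>exp (- (u\<^sup>2 * (k 0 + k t))) * cos (2 * a)\<bar> \<le> 1" "\<bar>m\<bar> \<le> 1"
        using 1 by (simp_all add: m_def abs_mult mult_le_one)
      moreover have "m\<^sup>2 \<le> 1" using \<open>\<bar>m\<bar> \<le> 1\<close> by (simp add: abs_square_le_1)
      moreover have "\<bar>(x + y) / 2 - z\<bar> \<le> 2"
        if "\<bar>y\<bar> \<le> 1" "z \<le> 1" "x \<le> 1" "0 < x" "0 \<le> z" for x y z :: real
        using that by (auto simp: abs_le_iff field_simps)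
      ultimately show ?thesis
        unfolding r_def using 1(1) by simp
    qed
    have "(r \<longlongrightarrow> (exp (- (u\<^sup>2 * (k 0 - 0))) + exp (- (u\<^sup>2 * (k 0 + 0))) * cos (2 * a)) / 2 - m\<^sup>2) at_top"
      unfolding r_def by (intro tendsto_intros k) simp
    moreover have "m\<^sup>2 = exp (- (u\<^sup>2 * k 0)) * (cos a)\<^sup>2"
      by (simp add: m_def power_mult_distrib exp_double[symmetric])
    moreover have "(x + x * cos (2 * a)) / 2 - x * (cos a)\<^sup>2 = 0" for x
      unfolding cos_double_cos by (simp add: field_simps)
    ultimately show "(r \<longlongrightarrow> 0) at_top"
      by simp
  qed (use h in auto)
  have c: "c \<ge> 0" using f(2)[of 1] abs_ge_zero[of "f 1"] by simp
  have "A.lln f"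
  proof (rule A.lln_continuous_if_lln_waves[OF waves f])
    show "integrable ?\<nu> (\<lambda>x. c * (1 + \<bar>x\<bar> ^ p))"
      using integrable_gauss_dens_poly[OF k(1), of c p]
      by (subst integrable_density) (auto simp: gauss_dens_nonneg)
    show "c * (1 + \<bar>x\<bar> ^ p) \<le> c * (1 + \<bar>y\<bar> ^ p)" if "\<bar>x\<bar> \<le> \<bar>y\<bar>" for x y :: real
      using that c by (intro mult_left_mono add_left_mono power_mono) auto
  qed
  moreover have "(\<integral>x. f x \<partial>?\<nu>) = (\<integral>z. gauss_dens (k 0) z * f z \<partial>lborel)"
    using f(1) by (subst integral_density) (auto simp: gauss_dens_nonneg borel_measurable_continuous_onI)
  ultimately show ?thesis
    unfolding A.lln_def A.dev_def by simp
qed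

lemma Z_polynomial_growth:
  fixes f :: "real \<Rightarrow> 'v :: euclidean_space"
  assumes t: "t \<ge> 0" and k: "k 0 > 0"
    and f: "f \<in> borel_measurable borel" "\<And>x. norm (f x) \<le> c * (1 + \<bar>x\<bar> ^ p)"
  shows "integrable M (\<lambda>\<omega>. f (Z t \<omega>))"
    and "expectation (\<lambda>\<omega>. f (Z t \<omega>)) = (\<integral>z. gauss_dens (k 0) z *\<^sub>R f z \<partial>lborel)"
proof -
  have Z: "Z t \<in> borel_measurable M" using t by (rule Z_measurable)
  have "integrable (distr M borel (Z t)) f"
    unfolding distr_Z[OF t k] using f integrable_gauss_dens_scaleR[OF k f]
    by (subst integrable_density) (auto simp: gauss_dens_nonneg)
  then show "integrable M (\<lambda>\<omega>. f (Z t \<omega>))"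
    by (rule integrable_distr[OF Z])
  have "expectation (\<lambda>\<omega>. f (Z t \<omega>)) = integral\<^sup>L (distr M borel (Z t)) f"
    using Z f(1) by (simp add: integral_distr)
  also have "\<dots> = (\<integral>z. gauss_dens (k 0) z *\<^sub>R f z \<partial>lborel)"
    unfolding distr_Z[OF t k] using f(1) by (subst integral_density) (auto simp: gauss_dens_nonneg)
  finally show "expectation (\<lambda>\<omega>. f (Z t \<omega>)) = (\<integral>z. gauss_dens (k 0) z *\<^sub>R f z \<partial>lborel)" .
qed

lemma gaussian_lln_vector:
  fixes f :: "real \<Rightarrow> 'v :: euclidean_space"
  assumes k: "k 0 > 0" "(k \<longlongrightarrow> 0) at_top"
    and h: "\<And>n. h n > 0" "filterlim (\<lambda>n. real n * h n) at_top sequentially"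
    and f: "continuous_on UNIV f" "\<And>x. norm (f x) \<le> c * (1 + \<bar>x\<bar> ^ p)"
  shows "(\<lambda>n. expectation (\<lambda>\<omega>. norm ((1 / real n) *\<^sub>R (\<Sum>i<n. f (Z (real i * h n) \<omega>))
      - (\<integral>z. gauss_dens (k 0) z *\<^sub>R f z \<partial>lborel)))) \<longlonglongrightarrow> 0"
proof (rule tendsto_sandwich[where f = "\<lambda>_. 0"])
  have f_meas: "f \<in> borel_measurable borel"
    using f(1) by (simp add: borel_measurable_continuous_onI)
  have t: "0 \<le> real i * h n" for i n using h(1)[of n] by simp
  let ?m = "\<integral>z. gauss_dens (k 0) z *\<^sub>R f z \<partial>lborel"
  let ?d = "\<lambda>b n \<omega>. \<bar>(\<Sum>i<n. f (Z (real i * h n) \<omega>) \<bullet> b) / real n - (\<integral>z. gauss_dens (k 0) z * (f z \<bullet> b) \<partial>lborel)\<bar>"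
  have "(\<lambda>n. \<Sum>b\<in>Basis. expectation (?d b n)) \<longlonglongrightarrow> (\<Sum>b\<in>(Basis :: 'v set). 0)"
  proof (intro tendsto_sum gaussian_lln[OF k h])
    fix b :: 'v assume b: "b \<in> Basis"
    show "continuous_on UNIV (\<lambda>x. f x \<bullet> b)" by (intro continuous_intros f)
    show "\<bar>f x \<bullet> b\<bar> \<le> c * (1 + \<bar>x\<bar> ^ p)" for x
      using Basis_le_norm[OF b, of "f x"] f(2)[of x] by simp
  qed
  then show "(\<lambda>n. \<Sum>b\<in>(Basis :: 'v set). expectation (?d b n)) \<longlonglongrightarrow> 0" by simp
  have d_int: "integrable M (?d b n)" for b n
    using Z_polynomial_growth(1)[OF t k(1) f_meas f(2)] by auto
  have "expectation (\<lambda>\<omega>. norm ((1 / real n) *\<^sub>R (\<Sum>i<n. f (Z (real i * h n) \<omega>)) - ?m))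
     \<le> (\<Sum>b\<in>Basis. expectation (?d b n))" for n
  proof -
    have comp: "(\<integral>z. gauss_dens (k 0) z * (f z \<bullet> b) \<partial>lborel) = ?m \<bullet> b" for b
      using integral_inner_left[OF integrable_gauss_dens_scaleR[OF k(1) f_meas f(2)], of b] by simp
    have "norm ((1 / real n) *\<^sub>R (\<Sum>i<n. f (Z (real i * h n) \<omega>)) - ?m) \<le> (\<Sum>b\<in>Basis. ?d b n \<omega>)" for \<omega>
      by (rule order_trans[OF norm_le_l1]) (simp add: inner_diff_left inner_sum_left comp)
    then have "expectation (\<lambda>\<omega>. norm ((1 / real n) *\<^sub>R (\<Sum>i<n. f (Z (real i * h n) \<omega>)) - ?m))
       \<le> expectation (\<lambda>\<omega>. \<Sum>b\<in>Basis. ?d b n \<omega>)"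
      by (intro integral_mono' Bochner_Integration.integrable_sum d_int) auto
    also have "\<dots> = (\<Sum>b\<in>Basis. expectation (?d b n))"
      by (intro Bochner_Integration.integral_sum d_int)
    finally show ?thesis .
  qed
  then show "\<forall>\<^sub>F n in sequentially. expectation (\<lambda>\<omega>. norm ((1 / real n) *\<^sub>R (\<Sum>i<n. f (Z (real i * h n) \<omega>)) - ?m))
     \<le> (\<Sum>b\<in>Basis. expectation (?d b n))" by simp
qed auto

end

section \<open>Increments, trends and convergence in probability\<close>

lemma abs_powr_le_power:
  fixes x C :: real
  assumes "C > 0"
  shows "\<bar>x\<bar> powr C \<le> 1 + \<bar>x\<bar> ^ nat \<lceil>C\<rceil>"
proof (cases "\<bar>x\<bar> \<le> 1")
  case True
  then show ?thesis
    using assms powr_le1[of C "\<bar>x\<bar>"] zero_le_power[OF abs_ge_zero, of x "nat \<lceil>C\<rceil>"] by linarith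
next
  case False
  have "\<bar>x\<bar> powr C \<le> \<bar>x\<bar> powr real (nat \<lceil>C\<rceil>)"
    using False by (intro powr_mono) linarith+
  then show ?thesis using False by (simp add: powr_realpow)
qed

text \<open>
  A natural exponent makes the growth bound a moment of the normal law.
\<close>

lemma polynomial_growth_if_powr_growth:
  fixes g :: "real \<Rightarrow> real"
  assumes "C > 0" "c > 0" "\<And>x. g x \<le> c * (1 + \<bar>x\<bar> powr C)"
  shows "g x \<le> 2 * c * (1 + \<bar>x\<bar> ^ nat \<lceil>C\<rceil>)"
proof -
  have "1 + a \<le> 2 * (1 + b)" if "a \<le> 1 + b" "0 \<le> b" for a b :: real
    using that by simp
  from this[OF abs_powr_le_power[OF assms(1), of x] zero_le_power[OF abs_ge_zero]]
  have "1 + \<bar>x\<bar> powr C \<le> 2 * (1 + \<bar>x\<bar> ^ nat \<lceil>C\<rceil>)" .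
  then have "c * (1 + \<bar>x\<bar> powr C) \<le> c * (2 * (1 + \<bar>x\<bar> ^ nat \<lceil>C\<rceil>))"
    using assms(2) by (intro mult_left_mono) auto
  with assms(3)[of x] have "g x \<le> c * (2 * (1 + \<bar>x\<bar> ^ nat \<lceil>C\<rceil>))" by (rule order_trans)
  then show ?thesis by (simp add: mult_ac)
qed

lemma one_plus_power_shift_le:
  fixes a :: real
  assumes "a \<ge> 0"
  shows "1 + (a + 1) ^ p \<le> 2 ^ Suc p * (1 + a ^ p)"
proof -
  have "(a + 1) ^ p \<le> (2 * max a 1) ^ p"
    using assms by (intro power_mono) auto
  also have "\<dots> \<le> 2 ^ p * (1 + a ^ p)"
    using assms by (auto simp: power_mult_distrib max_def)
  finally have "(a + 1) ^ p \<le> 2 ^ p * (1 + a ^ p)" .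
  moreover have "1 * 1 \<le> 2 ^ p * (1 + a ^ p)"
    using assms by (intro mult_mono) auto
  ultimately show ?thesis by simp
qed

text \<open>
  Mean value theorem on the unit ball around \<open>z\<close>. The bound is stated with \<open>z\<close> alone, so that it can
  be averaged over a stationary process while \<open>y\<close> is a perturbation of unknown law.
\<close>

lemma C1_increment_bound:
  fixes f :: "real \<Rightarrow> 'v :: euclidean_space"
  assumes f: "f C1_differentiable_on UNIV"
    and bound: "\<And>x. norm (vector_derivative f (at x)) \<le> c * (1 + \<bar>x\<bar> ^ p)"
    and d: "\<bar>y - z\<bar> \<le> d" "d \<le> 1"
  shows "norm (f y - f z) \<le> d * (c * 2 ^ Suc p * (1 + \<bar>z\<bar> ^ p))"
proof -
  have c: "c \<ge> 0" using order_trans[OF norm_ge_zero bound[of 1]] by simp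
  have der: "(f has_derivative (\<lambda>h. h *\<^sub>R vector_derivative f (at x))) (at x within cball z 1)" for x
    using f unfolding C1_differentiable_on_eq
    by (auto simp: vector_derivative_works has_vector_derivative_def intro: has_derivative_at_withinI)
  have "norm (f y - f z) \<le> (c * (1 + (\<bar>z\<bar> + 1) ^ p)) * norm (y - z)"
  proof (rule differentiable_bound[OF convex_cball der])
    fix x assume x: "x \<in> cball z 1"
    have "norm (vector_derivative f (at x)) \<le> c * (1 + \<bar>x\<bar> ^ p)" by (rule bound)
    also have "\<dots> \<le> c * (1 + (\<bar>z\<bar> + 1) ^ p)"
      using x c by (intro mult_left_mono add_left_mono power_mono) (auto simp: dist_real_def)
    finally show "onorm (\<lambda>h. h *\<^sub>R vector_derivative f (at x)) \<le> c * (1 + (\<bar>z\<bar> + 1) ^ p)"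
      by (intro onorm_le) (simp add: mult.commute mult_left_mono)
  qed (use d in \<open>auto simp: dist_real_def\<close>)
  also have "\<dots> \<le> (c * (2 ^ Suc p * (1 + \<bar>z\<bar> ^ p))) * d"
    using d c by (intro mult_mono mult_left_mono one_plus_power_shift_le) auto
  finally show ?thesis by (simp add: mult_ac)
qed

text \<open>
  The mean value inequality in the parameter holds at each time with the constant \<open>\<gamma>\<close>; integrating
  it over the whole half-line makes the Lipschitz constant independent of \<open>t\<close>.
\<close>

lemma trend_lipschitz:
  fixes \<mu> :: "'p :: euclidean_space \<Rightarrow> real \<Rightarrow> real"
  assumes S: "convex S" "\<xi> \<in> S" "\<zeta> \<in> S" and t: "t \<ge> 0"
    and int: "set_integrable lebesgue {0..t} (\<mu> \<xi>)" "set_integrable lebesgue {0..t} (\<mu> \<zeta>)"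
    and grad: "\<And>s x. s \<ge> 0 \<Longrightarrow> x \<in> S \<Longrightarrow> GDERIV (\<lambda>\<xi>. \<mu> \<xi> s) x :> \<mu>' x s"
    and bound: "\<And>s x. s \<ge> 0 \<Longrightarrow> x \<in> S \<Longrightarrow> norm (\<mu>' x s) \<le> \<gamma> s"
    and \<gamma>: "set_integrable lebesgue {0..} \<gamma>"
  shows "\<bar>trend \<mu> \<xi> t - trend \<mu> \<zeta> t\<bar> \<le> norm (\<xi> - \<zeta>) * set_lebesgue_integral lebesgue {0..} \<gamma>"
proof -
  have pointwise: "\<bar>\<mu> \<xi> s - \<mu> \<zeta> s\<bar> \<le> norm (\<xi> - \<zeta>) * \<gamma> s" if s: "s \<ge> 0" for s
  proof -
    have "norm (\<mu> \<xi> s - \<mu> \<zeta> s) \<le> \<gamma> s * norm (\<xi> - \<zeta>)"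
    proof (rule differentiable_bound[OF S(1) _ _ S(2,3)])
      fix x assume x: "x \<in> S"
      show "((\<lambda>\<xi>. \<mu> \<xi> s) has_derivative (\<lambda>h. h \<bullet> \<mu>' x s)) (at x within S)"
        using grad[OF s x] by (auto simp: gderiv_def intro: has_derivative_at_withinI)
      show "onorm (\<lambda>h. h \<bullet> \<mu>' x s) \<le> \<gamma> s"
      proof (rule onorm_le)
        fix h
        have "norm (h \<bullet> \<mu>' x s) \<le> norm h * norm (\<mu>' x s)"
          by (simp add: Cauchy_Schwarz_ineq2)
        also have "\<dots> \<le> \<gamma> s * norm h"
          using mult_left_mono[OF bound[OF s x] norm_ge_zero[of h]] by (simp add: mult.commute)
        finally show "norm (h \<bullet> \<mu>' x s) \<le> \<gamma> s * norm h" .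
      qed
    qed
    then show ?thesis by (simp add: mult.commute)
  qed
  have \<gamma>_nonneg: "0 \<le> \<gamma> s" if "s \<ge> 0" for s
    using order_trans[OF norm_ge_zero bound[OF that S(2)]] .
  have "trend \<mu> \<xi> t - trend \<mu> \<zeta> t = set_lebesgue_integral lebesgue {0..t} (\<lambda>s. \<mu> \<xi> s - \<mu> \<zeta> s)"
    unfolding trend_def using int by (simp add: set_integral_diff)
  also have "\<bar>\<dots>\<bar> \<le> (\<integral>s. \<bar>indicator {0..t} s *\<^sub>R (\<mu> \<xi> s - \<mu> \<zeta> s)\<bar> \<partial>lebesgue)"
    unfolding set_lebesgue_integral_def by (rule integral_abs_bound)
  also have "\<dots> \<le> (\<integral>s. norm (\<xi> - \<zeta>) * (indicator {0..} s *\<^sub>R \<gamma> s) \<partial>lebesgue)"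
    using \<gamma> pointwise \<gamma>_nonneg
    by (intro integral_mono') (auto simp: set_integrable_def indicator_def)
  also have "\<dots> = norm (\<xi> - \<zeta>) * set_lebesgue_integral lebesgue {0..} \<gamma>"
    unfolding set_lebesgue_integral_def by simp
  finally show ?thesis .
qed

lemma is_estimator_measurable:
  assumes "is_estimator M D n S T" "\<And>i. D i \<in> borel_measurable M"
  shows "T \<in> borel_measurable M"
proof -
  obtain g where g[measurable]: "g \<in> borel_measurable (PiM {0..n} (\<lambda>_. borel))"
    and T: "\<And>\<omega>. \<omega> \<in> space M \<Longrightarrow> T \<omega> = g (\<lambda>i\<in>{0..n}. D i \<omega>)"
    using assms(1) by (auto simp: is_estimator_def)
  have [measurable]: "D i \<in> borel_measurable M" for i by (rule assms(2))
  have "(\<lambda>\<omega>. g (\<lambda>i\<in>{0..n}. D i \<omega>)) \<in> borel_measurable M" by measurable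
  then show ?thesis using T by (simp cong: measurable_cong)
qed

text \<open>
  The setting of a plug-in estimator: \<open>T\<close> can be far from \<open>t\<close> only if the preliminary estimate \<open>S\<close>
  is off by more than \<open>\<delta>\<close> or if \<open>A + \<delta> B\<close> is at least \<open>\<eta>\<close>. By the Markov inequality the second event
  has probability at most \<open>(E A + \<delta> b) / \<eta>\<close>, where \<open>\<delta>\<close> is free and \<open>\<eta>\<close> does not depend on it.
\<close>

lemma (in prob_space) tendsto_in_prob_by_L1_domination:
  fixes S :: "nat \<Rightarrow> 'a \<Rightarrow> 'b :: {metric_space, second_countable_topology}"
  assumes S: "\<And>n. n \<ge> 1 \<Longrightarrow> S n \<in> borel_measurable M" "tendsto_in_prob M S s"
    and A: "\<And>n. integrable M (A n)" "\<And>n \<omega>. 0 \<le> A n \<omega>" "(\<lambda>n. expectation (A n)) \<longlonglongrightarrow> 0"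
    and B: "\<And>n. integrable M (B n)" "\<And>n \<omega>. 0 \<le> B n \<omega>" "\<And>n. expectation (B n) \<le> b"
    and \<delta>\<^sub>0: "\<delta>\<^sub>0 > 0"
    and dominated: "\<And>\<epsilon>. \<epsilon> > 0 \<Longrightarrow> \<exists>\<eta>>0. \<forall>n\<ge>1. \<forall>\<delta>. 0 < \<delta> \<and> \<delta> \<le> \<delta>\<^sub>0 \<longrightarrow>
       (AE \<omega> in M. dist (S n \<omega>) s \<le> \<delta> \<longrightarrow> dist (T n \<omega>) t > \<epsilon> \<longrightarrow> \<eta> \<le> A n \<omega> + \<delta> * B n \<omega>)"
  shows "tendsto_in_prob M T t"
  unfolding tendsto_in_prob_def
proof (intro allI impI LIMSEQ_I)
  fix \<epsilon> r :: real assume \<epsilon>: "\<epsilon> > 0" and r: "r > 0"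
  obtain \<eta> where \<eta>: "\<eta> > 0" and dom: "\<And>n \<delta>. n \<ge> 1 \<Longrightarrow> 0 < \<delta> \<Longrightarrow> \<delta> \<le> \<delta>\<^sub>0 \<Longrightarrow>
       AE \<omega> in M. dist (S n \<omega>) s \<le> \<delta> \<longrightarrow> dist (T n \<omega>) t > \<epsilon> \<longrightarrow> \<eta> \<le> A n \<omega> + \<delta> * B n \<omega>"
    using dominated[OF \<epsilon>] by blast
  have "0 \<le> expectation (B 0)" using B(2) by (intro Bochner_Integration.integral_nonneg) auto
  with B(3)[of 0] have b: "b \<ge> 0" by linarith
  define \<delta> where "\<delta> = min \<delta>\<^sub>0 (\<eta> * r / (3 * (b + 1)))"
  have \<delta>: "0 < \<delta>" "\<delta> \<le> \<delta>\<^sub>0" using \<delta>\<^sub>0 \<eta> r b by (auto simp: \<delta>_def)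
  have "\<delta> * b \<le> \<eta> * r / (3 * (b + 1)) * (b + 1)"
    using b \<delta>\<^sub>0 \<eta> r by (intro mult_mono) (auto simp: \<delta>_def)
  also have "\<dots> = \<eta> * r / 3" using b by (simp add: divide_simps)
  finally have \<delta>b: "\<delta> * b \<le> \<eta> * r / 3" .
  have "\<forall>\<^sub>F n in sequentially. prob {\<omega> \<in> space M. dist (S n \<omega>) s > \<delta>} < r / 3"
    using S(2) \<delta>(1) r unfolding tendsto_in_prob_def by (intro order_tendstoD) auto
  moreover have "\<forall>\<^sub>F n in sequentially. expectation (A n) < \<eta> * r / 3"
    using A(3) \<eta> r by (intro order_tendstoD) auto
  ultimately have "\<forall>\<^sub>F n in sequentially. norm (prob {\<omega> \<in> space M. dist (T n \<omega>) t > \<epsilon>} - 0) < r"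
    using eventually_ge_at_top[of 1]
  proof eventually_elim
    case (elim n)
    note [measurable] = S(1)[OF elim(3)] borel_measurable_integrable[OF A(1)]
      borel_measurable_integrable[OF B(1)]
    let ?far = "{\<omega> \<in> space M. dist (S n \<omega>) s > \<delta>}"
    let ?big = "{\<omega> \<in> space M. \<eta> \<le> A n \<omega> + \<delta> * B n \<omega>}"
    have "prob {\<omega> \<in> space M. dist (T n \<omega>) t > \<epsilon>} \<le> prob (?far \<union> ?big)"
      using dom[OF elim(3) \<delta>] by (intro finite_measure_mono_AE) (auto elim!: eventually_mono)
    also have "\<dots> \<le> prob ?far + prob ?big"
      by (rule measure_Un_le) auto
    also have "prob ?big \<le> expectation (\<lambda>\<omega>. A n \<omega> + \<delta> * B n \<omega>) / \<eta>"
      using A B \<delta>(1) \<eta> by (intro integral_Markov_inequality_measure[where A = "{}"]) auto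
    also have "expectation (\<lambda>\<omega>. A n \<omega> + \<delta> * B n \<omega>) = expectation (A n) + \<delta> * expectation (B n)"
      using A(1) B(1) by simp
    also have "(expectation (A n) + \<delta> * expectation (B n)) / \<eta> \<le> (\<eta> * r / 3 + \<eta> * r / 3) / \<eta>"
      using elim(2) \<delta>b \<delta>(1) B(3)[of n] \<eta>
      by (intro divide_right_mono add_mono order_trans[OF mult_left_mono[OF B(3)[of n]]]) auto
    also have "\<dots> = r / 3 + r / 3" using \<eta> by (simp add: field_simps)
    finally show ?case using elim(1) by simp
  qed
  then show "\<exists>no. \<forall>n\<ge>no. norm (prob {\<omega> \<in> space M. dist (T n \<omega>) t > \<epsilon>} - 0) < r"
    by (simp add: eventually_sequentially)
qed

section \<open>Consistency of the Z-estimator\<close>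

theorem theorem3p3:
  fixes M :: "'a measure"
    and XI_set :: "(real ^ 'p) set" and PI_set :: "(real ^ 'q) set"
    and \<mu> :: "real ^ 'p \<Rightarrow> real \<Rightarrow> real" and \<mu>' :: "real ^ 'p \<Rightarrow> real \<Rightarrow> real ^ 'p"
    and K :: "real ^ 'q \<Rightarrow> real \<Rightarrow> real" and K' K'' :: "real \<Rightarrow> real"
    and \<xi>\<^sub>0 :: "real ^ 'p" and \<sigma>\<^sub>0 :: "real ^ 'q"
    and Z X :: "real \<Rightarrow> 'a \<Rightarrow> real"
    and h :: "nat \<Rightarrow> real"
    and f :: "real \<Rightarrow> real ^ 'q"
    and \<xi>hat :: "nat \<Rightarrow> 'a \<Rightarrow> real ^ 'p" and \<sigma>tilde :: "nat \<Rightarrow> 'a \<Rightarrow> real ^ 'q"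
  assumes prob: "prob_space M"
    and Xi: "open XI_set" "convex XI_set" "bounded XI_set"
    and Pi: "open PI_set" "convex PI_set" "bounded PI_set"
    and true_value: "(\<xi>\<^sub>0, \<sigma>\<^sub>0) \<in> XI_set \<times> PI_set"
    and mu_int: "\<forall>\<xi>\<in>closure XI_set. \<forall>t\<ge>0. set_integrable lebesgue {0..t} (\<mu> \<xi>)"
    and K_pos: "\<forall>\<sigma>\<in>closure PI_set. \<forall>t\<ge>0. 0 < K \<sigma> t"
    and Z: "centered_stationary_gaussian M (K \<sigma>\<^sub>0) Z"
    and X: "\<forall>t\<ge>0. \<forall>\<omega>\<in>space M. X t \<omega> = Z t \<omega> + trend \<mu> \<xi>\<^sub>0 t"
    and h: "\<forall>n. 0 < h n" "h \<longlonglongrightarrow> 0" "filterlim (\<lambda>n. real n * h n) at_top sequentially"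
    and f_meas: "f \<in> borel_measurable borel"
    and f_C1: "f C1_differentiable_on UNIV"
    and f_growth: "\<exists>C>0. \<exists>c>0. \<forall>x.
          norm (f x) + norm (vector_derivative f (at x)) \<le> c * (1 + \<bar>x\<bar> powr C)"
    and K_i: "(K \<sigma>\<^sub>0 \<longlongrightarrow> 0) at_top"
    and K_C2: "C2_halfline (K \<sigma>\<^sub>0) K' K''"
    and K_ii: "K' 0 = 0" "\<bar>K'' 0\<bar> > 0"
              "(\<lambda>t. K \<sigma>\<^sub>0 t - (K \<sigma>\<^sub>0 0 + 1/2 * K'' 0 * t ^ 2)) \<in> o[at_right 0](\<lambda>t. t ^ 3)"
    and K_iii: "(K' \<longlongrightarrow> 0) at_top"
    and mu_iv: "\<forall>t\<ge>0. \<forall>\<xi>\<in>XI_set. GDERIV (\<lambda>\<xi>. \<mu> \<xi> t) \<xi> :> \<mu>' \<xi> t"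
               "\<exists>\<gamma>. bounded (\<gamma> ` {0..}) \<and> set_integrable lebesgue {0..} \<gamma> \<and>
                  (\<forall>t\<ge>0. (SUP \<xi>\<in>XI_set. ereal (norm (\<mu>' \<xi> t))) \<le> ereal (\<gamma> t))"
    and xihat: "\<forall>n\<ge>1. is_estimator M (\<lambda>i. X (obs_time h n i)) n (closure XI_set) (\<xi>hat n)"
               "tendsto_in_prob M \<xi>hat \<xi>\<^sub>0"
    and identifiable: "\<forall>\<epsilon>>0.
          (INF \<sigma>\<in>{\<sigma> \<in> closure PI_set. norm (\<sigma> - \<sigma>\<^sub>0) > \<epsilon>}. ereal (norm (Phi f K \<sigma>\<^sub>0 \<sigma>))) > 0"
    and sigmatilde: "\<forall>n\<ge>1. is_estimator M (\<lambda>i. X (obs_time h n i)) n (closure PI_set) (\<sigma>tilde n)"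
                    "\<forall>n\<ge>1. AE \<omega> in M. Phi_n f K \<mu> X h \<xi>hat n \<omega> (\<sigma>tilde n \<omega>) = 0"
  shows "tendsto_in_prob M \<sigma>tilde \<sigma>\<^sub>0"
proof -
  interpret prob_space M by (rule prob)
  interpret stationary_gaussian_process M "K \<sigma>\<^sub>0" Z
    by unfold_locales (rule Z)
  have \<xi>\<^sub>0: "\<xi>\<^sub>0 \<in> XI_set" and \<sigma>\<^sub>0: "\<sigma>\<^sub>0 \<in> closure PI_set"
    using true_value closure_subset by auto
  have K0: "0 < K \<sigma> 0" if "\<sigma> \<in> closure PI_set" for \<sigma> using K_pos that by blast
  have h_pos: "0 < h n" for n using h(1) by blast
  have time: "0 \<le> real i * h n" for i n using h_pos[of n] by simp
  have X_meas: "X (real i * h n) \<in> borel_measurable M" for i n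
  proof -
    have "Z (real i * h n) \<in> borel_measurable M" by (rule Z_measurable[OF time])
    then have "(\<lambda>\<omega>. Z (real i * h n) \<omega> + trend \<mu> \<xi>\<^sub>0 (real i * h n)) \<in> borel_measurable M"
      by measurable
    then show ?thesis using X time by (simp cong: measurable_cong)
  qed
  have \<xi>_meas: "\<xi>hat n \<in> borel_measurable M" if "n \<ge> 1" for n
    using is_estimator_measurable[of M "\<lambda>i. X (obs_time h n i)"] xihat(1) that X_meas
    by (auto simp: obs_time_def)

  obtain C c where C: "C > 0" "c > 0" and growth:
      "\<And>x. norm (f x) + norm (vector_derivative f (at x)) \<le> c * (1 + \<bar>x\<bar> powr C)"
    using f_growth by blast
  define p where "p = nat \<lceil>C\<rceil>"
  have f_bound: "norm (f x) \<le> 2 * c * (1 + \<bar>x\<bar> ^ p)"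
    and f'_bound: "norm (vector_derivative f (at x)) \<le> 2 * c * (1 + \<bar>x\<bar> ^ p)" for x
    using polynomial_growth_if_powr_growth[OF C growth, of x]
      norm_ge_zero[of "f x"] norm_ge_zero[of "vector_derivative f (at x)"]
    unfolding p_def by linarith+
  have f_cont: "continuous_on UNIV f"
    using f_C1 by (rule C1_differentiable_imp_continuous_on)

  obtain \<gamma> where \<gamma>: "set_integrable lebesgue {0..} \<gamma>"
    "\<And>t. t \<ge> 0 \<Longrightarrow> (SUP \<xi>\<in>XI_set. ereal (norm (\<mu>' \<xi> t))) \<le> ereal (\<gamma> t)"
    using mu_iv(2) by blast
  have \<mu>'_bound: "norm (\<mu>' \<xi> t) \<le> \<gamma> t" if "t \<ge> 0" "\<xi> \<in> XI_set" for \<xi> t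
    using order_trans[OF SUP_upper[OF that(2)] \<gamma>(2)[OF that(1)]] by simp
  \<comment> \<open>Adding one makes the Lipschitz constant positive, so that one may divide by it.\<close>
  define \<Gamma> where "\<Gamma> = \<bar>set_lebesgue_integral lebesgue {0..} \<gamma>\<bar> + 1"
  have \<Gamma>: "\<Gamma> > 0" by (simp add: \<Gamma>_def)
  obtain \<rho> where \<rho>: "\<rho> > 0" "cball \<xi>\<^sub>0 \<rho> \<subseteq> XI_set"
    using Xi(1) \<xi>\<^sub>0 open_contains_cball by blast
  \<comment> \<open>Within \<open>\<rho>\<close> the estimate lies in the open set where the gradient bound holds; within
    \<open>1 / \<Gamma>\<close> the residuals have distance at most 1 from the noise, as \<open>C1_increment_bound\<close> asks.\<close>
  define \<delta>\<^sub>0 where "\<delta>\<^sub>0 = min \<rho> (1 / \<Gamma>)"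

  define m where "m = (\<integral>z. gauss_dens (K \<sigma>\<^sub>0 0) z *\<^sub>R f z \<partial>lborel)"
  \<comment> \<open>\<open>H\<close> is the factor from \<open>C1_increment_bound\<close>, \<open>A\<close> the error of the law of large
    numbers, and \<open>\<delta> B\<close> bounds the plug-in error.\<close>
  define H where "H z = 2 * c * 2 ^ Suc p * (1 + \<bar>z\<bar> ^ p)" for z :: real
  define A where "A n \<omega> = norm ((1 / real n) *\<^sub>R (\<Sum>i<n. f (Z (real i * h n) \<omega>)) - m)" for n \<omega>
  define B where "B n \<omega> = \<Gamma> * ((\<Sum>i<n. H (Z (real i * h n) \<omega>)) / real n)" for n \<omega>
  define b where "b = (\<integral>z. gauss_dens (K \<sigma>\<^sub>0 0) z *\<^sub>R H z \<partial>lborel)"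
  have H_nonneg: "0 \<le> H z" for z using C by (simp add: H_def)
  have H_meas: "H \<in> borel_measurable borel" unfolding H_def by measurable
  have H_bound: "norm (H z) \<le> 2 * c * 2 ^ Suc p * (1 + \<bar>z\<bar> ^ p)" for z
    using H_nonneg[of z] by (simp add: H_def)
  note HZ = Z_polynomial_growth[OF time K0[OF \<sigma>\<^sub>0] H_meas H_bound]
  have b: "b \<ge> 0"
    unfolding b_def using H_nonneg gauss_dens_nonneg
    by (intro Bochner_Integration.integral_nonneg) auto

  show ?thesis
  proof (rule tendsto_in_prob_by_L1_domination[where S = \<xi>hat and s = \<xi>\<^sub>0 and A = A and B = B
        and b = "\<Gamma> * b" and \<delta>\<^sub>0 = \<delta>\<^sub>0])
    show "\<xi>hat n \<in> borel_measurable M" if "n \<ge> 1" for n by (rule \<xi>_meas[OF that])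
    show "tendsto_in_prob M \<xi>hat \<xi>\<^sub>0" by (rule xihat(2))
    show "integrable M (A n)" for n
      unfolding A_def using Z_polynomial_growth(1)[OF time K0[OF \<sigma>\<^sub>0] f_meas f_bound]
      by simp
    show "0 \<le> A n \<omega>" for n \<omega> by (simp add: A_def)
    show "(\<lambda>n. expectation (A n)) \<longlonglongrightarrow> 0"
      unfolding A_def m_def
      by (rule gaussian_lln_vector[OF K0[OF \<sigma>\<^sub>0] K_i h_pos h(3) f_cont f_bound])
    show "integrable M (B n)" for n unfolding B_def using HZ(1) by simp
    show "0 \<le> B n \<omega>" for n \<omega>
      unfolding B_def using \<Gamma> H_nonneg by (simp add: sum_nonneg)
    show "expectation (B n) \<le> \<Gamma> * b" for n
    proof -
      have "expectation (B n) = \<Gamma> * ((\<Sum>i<n. expectation (\<lambda>\<omega>. H (Z (real i * h n) \<omega>))) / real n)"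
        unfolding B_def using HZ(1) by simp
      also have "\<dots> = \<Gamma> * ((\<Sum>i<n. b) / real n)"
        unfolding HZ(2) b_def ..
      also have "\<dots> \<le> \<Gamma> * b" using \<Gamma> b by (cases "n = 0") auto
      finally show ?thesis .
    qed
    show "\<delta>\<^sub>0 > 0" using \<rho>(1) \<Gamma> by (simp add: \<delta>\<^sub>0_def)
  next
    fix \<epsilon> :: real assume "\<epsilon> > 0"
    then obtain \<eta>' where \<eta>': "0 < \<eta>'" "\<eta>' < (INF \<sigma>\<in>{\<sigma> \<in> closure PI_set. norm (\<sigma> - \<sigma>\<^sub>0) > \<epsilon>}. ereal (norm (Phi f K \<sigma>\<^sub>0 \<sigma>)))"
      using identifiable dense by blast
    obtain \<eta> where \<eta>: "\<eta>' = ereal \<eta>" using \<eta>' by (cases \<eta>') auto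
    have sep: "\<eta> \<le> norm (Phi f K \<sigma>\<^sub>0 \<sigma>)" if "\<sigma> \<in> closure PI_set" "dist \<sigma> \<sigma>\<^sub>0 > \<epsilon>" for \<sigma>
    proof -
      have "ereal \<eta> \<le> ereal (norm (Phi f K \<sigma>\<^sub>0 \<sigma>))"
        using \<eta>'(2) that unfolding \<eta> by (intro order_trans[OF less_imp_le INF_lower]) (auto simp: dist_norm)
      then show ?thesis by simp
    qed
    show "\<exists>\<eta>>0. \<forall>n\<ge>1. \<forall>\<delta>. 0 < \<delta> \<and> \<delta> \<le> \<delta>\<^sub>0 \<longrightarrow>
       (AE \<omega> in M. dist (\<xi>hat n \<omega>) \<xi>\<^sub>0 \<le> \<delta> \<longrightarrow> dist (\<sigma>tilde n \<omega>) \<sigma>\<^sub>0 > \<epsilon> \<longrightarrow> \<eta> \<le> A n \<omega> + \<delta> * B n \<omega>)"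
    proof (intro exI[of _ \<eta>] conjI allI impI)
      show "0 < \<eta>" using \<eta>'(1) \<eta> by simp
    next
      fix n :: nat and \<delta> :: real assume n: "n \<ge> 1" and \<delta>: "0 < \<delta> \<and> \<delta> \<le> \<delta>\<^sub>0"
      have \<delta>\<Gamma>: "\<delta> * \<Gamma> \<le> 1" "\<delta> \<le> \<rho>"
        using \<delta> \<Gamma> by (auto simp: \<delta>\<^sub>0_def field_simps)
      have "AE \<omega> in M. Phi_n f K \<mu> X h \<xi>hat n \<omega> (\<sigma>tilde n \<omega>) = 0"
        using sigmatilde(2) n by blast
      then show "AE \<omega> in M. dist (\<xi>hat n \<omega>) \<xi>\<^sub>0 \<le> \<delta> \<longrightarrow> dist (\<sigma>tilde n \<omega>) \<sigma>\<^sub>0 > \<epsilon> \<longrightarrow> \<eta> \<le> A n \<omega> + \<delta> * B n \<omega>"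
        using AE_space
      proof (eventually_elim, intro impI)
        fix \<omega> assume zero: "Phi_n f K \<mu> X h \<xi>hat n \<omega> (\<sigma>tilde n \<omega>) = 0" and \<omega>: "\<omega> \<in> space M"
          and near: "dist (\<xi>hat n \<omega>) \<xi>\<^sub>0 \<le> \<delta>" and far: "dist (\<sigma>tilde n \<omega>) \<sigma>\<^sub>0 > \<epsilon>"
        have \<sigma>: "\<sigma>tilde n \<omega> \<in> closure PI_set"
          using sigmatilde(1) n \<omega> by (auto simp: is_estimator_def)
        have \<xi>: "\<xi>hat n \<omega> \<in> XI_set"
          using near \<delta>\<Gamma>(2) \<rho>(2) by (auto simp: dist_commute)
        let ?Y = "\<lambda>i. Y_resid \<mu> X h \<xi>hat n i \<omega>" and ?Z = "\<lambda>i. Z (real i * h n) \<omega>"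
        have YZ: "\<bar>?Y i - ?Z i\<bar> \<le> \<delta> * \<Gamma>" for i
        proof -
          have "\<bar>?Y i - ?Z i\<bar> = \<bar>trend \<mu> \<xi>\<^sub>0 (real i * h n) - trend \<mu> (\<xi>hat n \<omega>) (real i * h n)\<bar>"
            using X \<omega> time[of i n] by (simp add: Y_resid_def obs_time_def)
          also have "\<dots> \<le> norm (\<xi>\<^sub>0 - \<xi>hat n \<omega>) * set_lebesgue_integral lebesgue {0..} \<gamma>"
            using mu_iv(1) mu_int closure_subset[of XI_set] \<xi> \<xi>\<^sub>0 time
            by (intro trend_lipschitz[OF Xi(2), where \<mu>' = \<mu>'] \<gamma>(1) \<mu>'_bound) blast+
          also have "\<dots> \<le> norm (\<xi>\<^sub>0 - \<xi>hat n \<omega>) * \<Gamma>"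
            by (intro mult_left_mono) (auto simp: \<Gamma>_def)
          also have "\<dots> \<le> \<delta> * \<Gamma>"
            using near \<Gamma> by (intro mult_right_mono) (auto simp: dist_norm norm_minus_commute)
          finally show ?thesis .
        qed
        have fYZ: "norm (f (?Y i) - f (?Z i)) \<le> \<delta> * \<Gamma> * H (?Z i)" for i
          unfolding H_def by (rule C1_increment_bound[OF f_C1 f'_bound YZ \<delta>\<Gamma>(1)])
        have int: "integrable lborel (\<lambda>z. gauss_dens (K \<sigma> 0) z *\<^sub>R f z)" if "\<sigma> \<in> closure PI_set" for \<sigma>
          by (rule integrable_gauss_dens_scaleR[OF K0[OF that] f_meas f_bound])
        have "Phi f K \<sigma>\<^sub>0 (\<sigma>tilde n \<omega>) = m - (\<integral>z. gauss_dens (K (\<sigma>tilde n \<omega>) 0) z *\<^sub>R f z \<partial>lborel)"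
          unfolding Phi_def m_def using int[OF \<sigma>] int[OF \<sigma>\<^sub>0] by (simp add: scaleR_left_diff_distrib)
        also have "\<dots> = m - (1 / real n) *\<^sub>R (\<Sum>i<n. f (?Y i))"
          using zero by (simp add: Phi_n_def sum.atLeast1_atMost_eq)
        also have "\<dots> = - ((1 / real n) *\<^sub>R (\<Sum>i<n. f (?Z i)) - m)
            - (1 / real n) *\<^sub>R (\<Sum>i<n. f (?Y i) - f (?Z i))"
          by (simp add: sum_subtractf scaleR_right_diff_distrib)
        finally have split: "Phi f K \<sigma>\<^sub>0 (\<sigma>tilde n \<omega>) = - ((1 / real n) *\<^sub>R (\<Sum>i<n. f (?Z i)) - m)
            - (1 / real n) *\<^sub>R (\<Sum>i<n. f (?Y i) - f (?Z i))" .
        have "norm (Phi f K \<sigma>\<^sub>0 (\<sigma>tilde n \<omega>)) \<le>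
            norm (- ((1 / real n) *\<^sub>R (\<Sum>i<n. f (?Z i)) - m))
              + norm ((1 / real n) *\<^sub>R (\<Sum>i<n. f (?Y i) - f (?Z i)))"
          unfolding split by (rule norm_triangle_ineq4)
        also have "norm (- ((1 / real n) *\<^sub>R (\<Sum>i<n. f (?Z i)) - m)) = A n \<omega>"
          unfolding A_def by (rule norm_minus_cancel)
        also have "norm ((1 / real n) *\<^sub>R (\<Sum>i<n. f (?Y i) - f (?Z i))) \<le>
            (\<Sum>i<n. \<delta> * \<Gamma> * H (?Z i)) / real n"
          using sum_norm_le[of "{..<n}" "\<lambda>i. f (?Y i) - f (?Z i)", OF fYZ] by (simp add: divide_right_mono)
        also have "\<dots> = \<delta> * B n \<omega>"
          by (simp add: B_def sum_distrib_left mult.assoc)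
        finally have "norm (Phi f K \<sigma>\<^sub>0 (\<sigma>tilde n \<omega>)) \<le> A n \<omega> + \<delta> * B n \<omega>" by simp
        then show "\<eta> \<le> A n \<omega> + \<delta> * B n \<omega>"
          using sep[OF \<sigma> far] by linarith
      qed
    qed
  qed
qed

end
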